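(* Let $v$ be the solution of the Navier-Stokes problem $$v'+(v,\nabla)v=-\nabla p+\nu\Delta v+f,\quad \nabla\cdot v=0,\quad v(x,0)=v_0(x),\qquad x\in\mathbb{R}^3,\ t\ge0,$$ in the sense described in the context. Let $E(t)=\int_{\mathbb{R}^3}|v(x,t)|^2dx$ and $\mathcal{N}(f)=\mathcal N(f)(t)=\big(\int_{\mathbb{R}^3}|f(x,t)|^2dx\big)^{1/2}$. Assume that $\int_0^T\mathcal{N}(f)\,dt<\infty$ for all $T>0$ and $E(0)<\infty$. Then $$\sup_{t\in[0,T]}E(t)<\infty\qquad\text{and}\qquad\int_0^T\|\nabla v(x,t)\|^2dt<\infty\qquad\text{for all }T>0 .$$
   Context: Here $v=v(x,t)$ and $f=f(x,t)$ are vector-functions with values in $\mathbb{R}^3$, $p=p(x,t)$ is a scalar function, $v'=\partial v/\partial t$, $(v,\nabla)v=\sum_j v_j\partial_{x_j}v$, and $\|\nabla v(x,t)\|^2=\int_{\mathbb{R}^3}\sum_{j}\nabla v_j(x,t)\cdot\nabla v_j(x,t)\,dx$. Standing assumptions: $\nu>0$ is a constant; $\nabla\cdot v_0=0$; for some $a>3$, $|v_0|+|\nabla v_0|=O((1+|x|)^{-a})$ as $|x|\to\infty$, and $|f|+|\nabla f|=O((1+|x|)^{-a})$ as $|x|\to\infty$ uniformly in $t\in[0,T]$ for every $T>0$. The functions $v,f,p$ decay as $|x|\to\infty$ uniformly with respect to $t\in[0,T]$. Notion of solution: for $t>0$ let $$g(x,t)=\frac{e^{-|x|^2/(4\nu t)}}{(4\nu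 t\pi)^{3/2}},\qquad g(x,0)=\delta(x),$$ $$G_{jm}(x,t)=\delta_{jm}\,g(x,t)+\frac{1}{2\pi^{3/2}}\frac{\partial^2}{\partial x_j\partial x_m}\Big(\frac1{|x|}\int_0^{|x|/(4\nu t)^{1/2}}e^{-s^2}ds\Big),\qquad G=(G_{jm})_{1\le j,m\le3}.$$ A solution of the Navier-Stokes problem is by definition a solution $v$ of the integral equation $$v(x,t)=\int_0^t ds\int_{\mathbb{R}^3}G(x-y,t-s)\,[f(y,s)-(v(y,s),\nabla)v(y,s)]\,dy+\int_{\mathbb{R}^3}g(x-y,t)v_0(y)\,dy,\qquad t\ge0,$$ such that for every $T>0$ the norm $\sup_{x\in\mathbb{R}^3,\,t\in[0,T]}(|v(x,t)|+|\nabla v(x,t)|)(1+|x|)$ is finite, $v$ being continuously differentiable in $x$. *)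

theory Defs
  imports "HOL-Analysis.Analysis" "HOL-Library.Landau_Symbols"
begin

text \<open>
  A time-dependent field is a curried function \<open>u x t\<close> of position and time; only its values
  for \<open>t \<ge> 0\<close> matter.
\<close>

type_synonym vec3 = "real ^ 3"
type_synonym vfield = "vec3 \<Rightarrow> vec3"
type_synonym tvfield = "vec3 \<Rightarrow> real \<Rightarrow> vec3"

text \<open>Row \<open>j\<close> of the spatial Jacobian is the gradient of the component \<open>u\<^sub>j\<close>,
  column \<open>j\<close> is \<open>\<partial>u/\<partial>x\<^sub>j\<close>; its norm as an element of \<open>real^3^3\<close> is the Frobenius norm.\<close>

definition grad :: "tvfield \<Rightarrow> vec3 \<Rightarrow> real \<Rightarrow> real ^ 3 ^ 3" where
  "grad u x t = jacobian (\<lambda>y. u y t) (at x)"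

definition divergence :: "vfield \<Rightarrow> vec3 \<Rightarrow> real" where
  "divergence w x = (\<Sum>j\<in>UNIV. jacobian w (at x) $ j $ j)"

definition convect :: "tvfield \<Rightarrow> vec3 \<Rightarrow> real \<Rightarrow> vec3" where
  "convect u x t = (\<Sum>j\<in>UNIV. (u x t $ j) *\<^sub>R column j (grad u x t))"

definition energy :: "tvfield \<Rightarrow> real \<Rightarrow> ennreal" where
  "energy u t = (\<integral>\<^sup>+ x. ennreal ((norm (u x t))\<^sup>2) \<partial>lborel)"

definition grad_norm_sq :: "tvfield \<Rightarrow> real \<Rightarrow> ennreal" where
  "grad_norm_sq u t =
     (\<integral>\<^sup>+ x. ennreal (\<Sum>j\<in>UNIV. inner (grad u x t $ j) (grad u x t $ j)) \<partial>lborel)"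

definition ennreal_sqrt :: "ennreal \<Rightarrow> ennreal" where
  "ennreal_sqrt c = (if c = \<infinity> then \<infinity> else ennreal (sqrt (enn2real c)))"

definition L2_norm_at :: "tvfield \<Rightarrow> real \<Rightarrow> ennreal" where
  "L2_norm_at u t = ennreal_sqrt (\<integral>\<^sup>+ x. ennreal ((norm (u x t))\<^sup>2) \<partial>lborel)"


text \<open>Limits along \<open>unif_at_infinity T\<close> are limits as \<open>|x| \<rightarrow> \<infinity>\<close>, uniform in \<open>t \<in> [0,T]\<close>.\<close>

definition unif_at_infinity :: "real \<Rightarrow> (vec3 \<times> real) filter" where
  "unif_at_infinity T = at_infinity \<times>\<^sub>F principal {0..T}"

definition decays_uniformly :: "(vec3 \<Rightarrow> real \<Rightarrow> 'a::real_normed_vector) \<Rightarrow> bool" where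
  "decays_uniformly u \<longleftrightarrow>
     (\<forall>T>0. ((\<lambda>(x, t). u x t) \<longlongrightarrow> 0) (unif_at_infinity T))"

definition jointly_measurable :: "tvfield \<Rightarrow> bool" where
  "jointly_measurable u \<longleftrightarrow>
     (\<lambda>(x, t). u x t) \<in> borel_measurable (restrict_space borel (UNIV \<times> {0..}))"


definition heat_kernel :: "real \<Rightarrow> vec3 \<Rightarrow> real \<Rightarrow> real" where
  "heat_kernel \<nu> x t = exp (- (norm x)\<^sup>2 / (4 * \<nu> * t)) / (4 * \<nu> * t * pi) powr (3 / 2)"

definition partial_deriv :: "3 \<Rightarrow> (vec3 \<Rightarrow> real) \<Rightarrow> vec3 \<Rightarrow> real" where
  "partial_deriv j h x = deriv (\<lambda>r. h (x + r *\<^sub>R axis j 1)) 0"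

text \<open>The function \<open>x \<mapsto> (1/|x|) \<integral>\<^sub>0\<^bsup>|x|/\<surd>(4\<nu>t)\<^esup> exp(-s\<^sup>2) ds\<close>, extended smoothly across \<open>x = 0\<close>.\<close>

definition kernel_potential :: "real \<Rightarrow> real \<Rightarrow> vec3 \<Rightarrow> real" where
  "kernel_potential \<nu> t x =
     (if x = 0 then 1 / sqrt (4 * \<nu> * t)
      else (1 / norm x) * integral {0..norm x / sqrt (4 * \<nu> * t)} (\<lambda>s. exp (- s\<^sup>2)))"

definition NS_kernel :: "real \<Rightarrow> vec3 \<Rightarrow> real \<Rightarrow> real ^ 3 ^ 3" where
  "NS_kernel \<nu> x t =
     (\<chi> j m. (if j = m then heat_kernel \<nu> x t else 0)
            + 1 / (2 * pi powr (3 / 2))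
              * partial_deriv j (partial_deriv m (kernel_potential \<nu> t)) x)"

text \<open>The case \<open>t = 0\<close> is the convention that the heat kernel at time \<open>0\<close> is the Dirac delta.\<close>

definition heat_flow :: "real \<Rightarrow> vfield \<Rightarrow> vec3 \<Rightarrow> real \<Rightarrow> vec3" where
  "heat_flow \<nu> w x t =
     (if t = 0 then w x
      else (\<integral>y. heat_kernel \<nu> (x - y) t *\<^sub>R w y \<partial>lborel))"

definition duhamel_integrand ::
    "real \<Rightarrow> tvfield \<Rightarrow> tvfield \<Rightarrow> vec3 \<Rightarrow> real \<Rightarrow> real \<Rightarrow> vec3 \<Rightarrow> vec3" where
  "duhamel_integrand \<nu> f u x t s y = NS_kernel \<nu> (x - y) (t - s) *v (f y s - convect u y s)"

text \<open>
  Lebesgue integrals are total functions with value \<open>0\<close> on non-integrable arguments, so convergence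
  of the iterated integral is part of what it means to satisfy the integral equation.
\<close>

definition satisfies_integral_eq ::
    "real \<Rightarrow> tvfield \<Rightarrow> vfield \<Rightarrow> tvfield \<Rightarrow> bool" where
  "satisfies_integral_eq \<nu> f v0 u \<longleftrightarrow>
     (\<forall>x. \<forall>t\<ge>0.
        (AE s in lborel. s \<in> {0..t} \<longrightarrow> integrable lborel (duhamel_integrand \<nu> f u x t s)) \<and>
        set_integrable lborel {0..t} (\<lambda>s. \<integral>y. duhamel_integrand \<nu> f u x t s y \<partial>lborel) \<and>
        u x t = (LBINT s:{0..t}. (\<integral>y. duhamel_integrand \<nu> f u x t s y \<partial>lborel))
                + heat_flow \<nu> v0 x t)"

definition NS_solution :: "real \<Rightarrow> tvfield \<Rightarrow> vfield \<Rightarrow> tvfield \<Rightarrow> bool" where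
  "NS_solution \<nu> f v0 u \<longleftrightarrow>
     jointly_measurable u \<and>
     (\<forall>t\<ge>0. (\<forall>x. (\<lambda>y. u y t) differentiable (at x)) \<and> continuous_on UNIV (\<lambda>x. grad u x t)) \<and>
     (\<forall>T>0. bdd_above
        ((\<lambda>(x, t). (norm (u x t) + norm (grad u x t)) * (1 + norm x)) ` (UNIV \<times> {0..T}))) \<and>
     satisfies_integral_eq \<nu> f v0 u"

end

theory Submission
  imports Defs
begin

text \<open>
  The class of solutions considered turns the claim into one about a linear equation with a given
  forcing. Since \<open>|v|\<close> and \<open>|\<nabla>v|\<close> are \<open>O(1/|x|)\<close> uniformly on \<open>[0,T]\<close>, the convection term \<open>(v,\<nabla>)v\<close> is
  \<open>O(|x|^(-2))\<close>, and so is the total forcing \<open>F = f - (v,\<nabla>)v\<close> outside a ball. The theorem then expresses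
  that the linear solution operator improves the decay of \<open>v\<close> and \<open>\<nabla>v\<close> from \<open>|x|^(-1)\<close>, which is not square
  integrable over space, to almost \<open>|x|^(-2)\<close>, which is.

  Write \<open>c = \<surd>(4\<nu>t)\<close> for the diffusion length. The kernel \<open>G\<close> is the heat kernel plus an average of
  Gaussian Hessians over widths larger than \<open>c\<close>, which gives \<open>|G(z,t)| \<le> C (c + |z|)^(-3)\<close> and a gradient bound
  \<open>C (c + |z|)^(-4)\<close>, the latter in the form of a Lipschitz estimate (\<open>NS_kernel_bounds\<close>). Convolving
  \<open>(c + |z|)^(-3)\<close> with \<open>(1 + |y|)^(-2)\<close> yields \<open>(1 + |x|)^(-7/4)\<close> at the cost of a factor \<open>c^(-1/4)\<close>
  (\<open>convolution_decay\<close>), and the gradient costs one more factor \<open>1/c\<close>. Both losses are integrable in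
  time. Inside the ball \<open>f\<close> is only known to be integrable in time with values in \<open>L\<^sup>2\<close>, but seen from
  far away the kernel has no singularity at all, so this part contributes a bounded multiple of
  \<open>|x|^(-3)\<close>. The two parts are combined in \<open>duhamel_bound\<close> and \<open>duhamel_decay\<close>.

  The initial datum is in the class \<open>O(|x|^(-a))\<close> with \<open>a > 3\<close>, and its heat flow stays below a multiple of
  \<open>(1 + |x|)^(-7/4)\<close>, uniformly down to \<open>t = 0\<close> (\<open>heat_flow_decay\<close>). Hence
  \<open>|v| \<le> C (1 + |x|)^(-7/4)\<close>, which bounds the energy. Difference quotients of the integral equation,
  estimated uniformly in the increment, give \<open>|\<nabla>v| \<le> C t^(-5/8) (1 + |x|)^(-7/4)\<close>. The square of
  this is not integrable at \<open>t = 0\<close>, but interpolating with the a priori bound \<open>O(1/|x|)\<close>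
  repairs this and keeps integrability in space (\<open>energy_class_bounds\<close>).
\<close>

section \<open>Power weights on space and time\<close>

lemma dyadic_scale:
  fixes r :: real
  assumes "r \<ge> 1"
  obtains k :: nat where "2 ^ k \<le> r" "r < 2 ^ Suc k"
proof -
  define k where "k = nat \<lfloor>log 2 r\<rfloor>"
  have "log 2 r \<ge> 0" using assms by simp
  then have k: "real k \<le> log 2 r" "log 2 r < real k + 1"
    unfolding k_def by linarith+
  have "2 powr real k \<le> r" "r < 2 powr (real k + 1)"
    using k assms by (simp_all add: le_log_iff log_less_iff)
  then show thesis
    by (intro that[of k]) (simp_all add: powr_realpow powr_add)
qed

lemma ennreal_le_suminf: "g k \<le> (\<Sum>k. g k)" for g :: "nat \<Rightarrow> ennreal"
  using sum_le_suminf[OF summableI, of "{k}" g] by simp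

text \<open>
  A dyadic decomposition: on the shell \<open>c 2\<^sup>k \<le> c + |x - y| < c 2^(k+1)\<close> the integrand is at most
  \<open>(c 2\<^sup>k)^(-p)\<close>, and the shell lies in a ball of volume proportional to \<open>(c 2\<^sup>k)\<^sup>3\<close>, so the shells
  contribute a geometric series of ratio \<open>2^(3-p) < 1\<close>. The exact power of \<open>c\<close> is needed later: it is
  the rate at which kernel integrals blow up as the diffusion length \<open>c\<close> tends to \<open>0\<close>.
\<close>

lemma nn_integral_decay:
  fixes p :: real
  assumes "p > 3"
  obtains K where "K \<ge> 0"
    "\<And>c x. c > 0 \<Longrightarrow> (\<integral>\<^sup>+ y. ennreal ((c + norm (x - y :: vec3)) powr (- p)) \<partial>lborel)
       \<le> ennreal (K * c powr (3 - p))"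
proof -
  define V where "V = unit_ball_vol (real DIM(vec3))"
  define \<rho> :: real where "\<rho> = 2 powr (3 - p)"
  have V: "V \<ge> 0" by (simp add: V_def)
  have \<rho>: "0 < \<rho>" "\<rho> < 1" using assms by (simp_all add: \<rho>_def powr_less_one)
  define K where "K = 8 * V / (1 - \<rho>)"
  have "K \<ge> 0" using V \<rho> by (simp add: K_def)
  moreover
  have "(\<integral>\<^sup>+ y. ennreal ((c + norm (x - y)) powr (- p)) \<partial>lborel) \<le> ennreal (K * c powr (3 - p))"
    if c: "c > 0" for c and x :: vec3
  proof -
    let ?g = "\<lambda>k y. ennreal ((c * 2 ^ k) powr (- p)) * indicator (cball x (c * 2 ^ Suc k)) y"
    have pw: "ennreal ((c + norm (x - y)) powr (- p)) \<le> (\<Sum>k. ?g k y)" for y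
    proof -
      have "(c + norm (x - y)) / c \<ge> 1" using c by simp
      then obtain k :: nat where k: "2 ^ k \<le> (c + norm (x - y)) / c" "(c + norm (x - y)) / c < 2 ^ Suc k"
        by (rule dyadic_scale)
      have 1: "c * 2 ^ k \<le> c + norm (x - y)" and "c + norm (x - y) < c * 2 ^ Suc k"
        using k c by (simp_all add: field_simps)
      then have 2: "y \<in> cball x (c * 2 ^ Suc k)" using c by (simp add: dist_norm)
      have "(c + norm (x - y)) powr (- p) \<le> (c * 2 ^ k) powr (- p)"
        using 1 c assms by (intro powr_mono2') auto
      then have "ennreal ((c + norm (x - y)) powr (- p)) \<le> ?g k y"
        using 2 by (simp add: ennreal_leI)
      also have "\<dots> \<le> (\<Sum>k. ?g k y)"
        by (rule ennreal_le_suminf)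
      finally show ?thesis .
    qed
    have shell: "(\<integral>\<^sup>+ y. ?g k y \<partial>lborel) = ennreal (c powr (3 - p) * (8 * V) * \<rho> ^ k)" for k
    proof -
      have r: "0 \<le> c * 2 ^ Suc k" using c by simp
      have "(\<integral>\<^sup>+ y. ?g k y \<partial>lborel)
          = ennreal ((c * 2 ^ k) powr (- p)) * ennreal (V * (c * 2 ^ Suc k) ^ 3)"
        using emeasure_cball[OF r, of x] by (subst nn_integral_cmult_indicator) (simp_all add: V_def)
      also have "\<dots> = ennreal ((c * 2 ^ k) powr (- p) * (V * (c * 2 ^ Suc k) ^ 3))"
        using V c by (intro ennreal_mult[symmetric]) auto
      also have "(c * 2 ^ k) powr (- p) * (V * (c * 2 ^ Suc k) ^ 3)
          = (c * 2 ^ k) powr (- p) * (c * 2 ^ k) powr 3 * (8 * V)"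
        using c by (simp add: power_mult_distrib)
      also have "(c * 2 ^ k) powr (- p) * (c * 2 ^ k) powr 3 = (c * 2 ^ k) powr (3 - p)"
        by (simp flip: powr_add)
      also have "\<dots> = c powr (3 - p) * (2 powr real k) powr (3 - p)"
        using c by (simp add: powr_mult powr_realpow)
      also have "(2 powr real k) powr (3 - p) = \<rho> ^ k"
        unfolding \<rho>_def by (subst powr_powr, subst powr_power) (simp_all add: mult.commute)
      finally show ?thesis by (simp add: mult_ac)
    qed
    have "(\<integral>\<^sup>+ y. ennreal ((c + norm (x - y)) powr (- p)) \<partial>lborel) \<le> (\<integral>\<^sup>+ y. (\<Sum>k. ?g k y) \<partial>lborel)"
      by (intro nn_integral_mono pw)
    also have "\<dots> = (\<Sum>k. \<integral>\<^sup>+ y. ?g k y \<partial>lborel)"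
      by (intro nn_integral_suminf borel_measurable_times_ennreal borel_measurable_const
          borel_measurable_indicator) auto
    also have "\<dots> = (\<Sum>k. ennreal (c powr (3 - p) * (8 * V) * \<rho> ^ k))"
      by (intro suminf_cong shell)
    also have "\<dots> = ennreal (c powr (3 - p) * (8 * V) * (1 / (1 - \<rho>)))"
      using V \<rho> by (intro suminf_ennreal_eq sums_mult geometric_sums) (simp_all)
    finally show ?thesis by (simp add: K_def mult_ac)
  qed
  ultimately show thesis by (rule that)
qed

text \<open>
  The pointwise form of a convolution estimate. Since \<open>W \<le> a + b\<close>, one of \<open>a\<close>, \<open>b\<close> is at least \<open>W/2\<close>,
  so the factor \<open>W^(-7/4)\<close> can be split off that variable; weights of total degree \<open>-13/4\<close> are
  left. The exponents are a compromise: \<open>13/4 > 3\<close> makes both remaining weights integrable over space,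
  while \<open>7/4 > 3/2\<close> makes the extracted decay square integrable.
\<close>

lemma powr_split_le:
  fixes a b W :: real
  assumes "0 < a" "0 < b" "0 < W" "W \<le> a + b"
  shows "a powr (-3) * b powr (-2)
    \<le> 4 * W powr (-7/4) * (a powr (-13/4) + b powr (-13/4))"
proof -
  \<comment> \<open>in a product of negative powers, replacing both bases by the smaller one only increases it\<close>
  have wt: "a powr (-\<alpha>) * b powr (-\<beta>) \<le> a powr (-13/4) + b powr (-13/4)"
    if "\<alpha> \<ge> 0" "\<beta> \<ge> 0" "\<alpha> + \<beta> = 13/4" for \<alpha> \<beta>
  proof (cases "a \<le> b")
    have deg: "-\<alpha> + -\<beta> = -13/4" using that by simp
    case True
    have "a powr (-\<alpha>) * b powr (-\<beta>) \<le> a powr (-\<alpha>) * a powr (-\<beta>)"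
      using True assms that by (intro mult_left_mono powr_mono2') auto
    also have "\<dots> = a powr (-13/4)" unfolding deg[symmetric] powr_add ..
    finally show ?thesis by (simp add: add_increasing2)
  next
    have deg: "-\<alpha> + -\<beta> = -13/4" using that by simp
    case False
    have "a powr (-\<alpha>) * b powr (-\<beta>) \<le> b powr (-\<alpha>) * b powr (-\<beta>)"
      using False assms that by (intro mult_right_mono powr_mono2') auto
    also have "\<dots> = b powr (-13/4)" unfolding deg[symmetric] powr_add ..
    finally show ?thesis by (simp add: add_increasing)
  qed
  have half: "(W / 2) powr (-7/4) \<le> 4 * W powr (-7/4)"
  proof -
    have "(W / 2) powr (-7/4) = 2 powr (7/4) * W powr (-7/4)"
      using assms by (simp add: powr_divide powr_minus field_simps)
    also have "\<dots> \<le> 2 powr 2 * W powr (-7/4)"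
      by (intro mult_right_mono powr_mono) auto
    finally show ?thesis by simp
  qed
  consider "W / 2 \<le> a" | "W / 2 \<le> b" using assms by linarith
  then show ?thesis
  proof cases
    case 1
    have "a powr (-3) * b powr (-2) = a powr (-7/4) * (a powr (-(5/4)) * b powr (-2))"
      by (simp flip: powr_add mult.assoc)
    also have "\<dots> \<le> (4 * W powr (-7/4)) * (a powr (-13/4) + b powr (-13/4))"
      using 1 assms by (intro mult_mono wt order.trans[OF powr_mono2' half]) auto
    finally show ?thesis .
  next
    case 2
    have "a powr (-3) * b powr (-2) = b powr (-7/4) * (a powr (-3) * b powr (-(1/4)))"
      using powr_add[of b "-7/4" "-(1/4)"] by (simp add: mult.left_commute)
    also have "\<dots> \<le> (4 * W powr (-7/4)) * (a powr (-13/4) + b powr (-13/4))"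
      using 2 assms by (intro mult_mono wt order.trans[OF powr_mono2' half]) auto
    finally show ?thesis .
  qed
qed

text \<open>
  A kernel of size \<open>(c + |z|)^(-3)\<close> just fails to be integrable at infinity, and at the origin when
  \<open>c = 0\<close>. Giving up a power \<open>1/4\<close> of decay cures both: the price at small \<open>c\<close> is only
  \<open>c^(-1/4)\<close>, which is integrable in time.
\<close>

lemma convolution_decay:
  obtains K where "K \<ge> 0"
    "\<And>c x. c > 0 \<Longrightarrow>
       (\<integral>\<^sup>+ y. ennreal ((c + norm (x - y :: vec3)) powr (-3) * (1 + norm y) powr (-2)) \<partial>lborel)
       \<le> ennreal (K * (c powr (-1/4) + 1) * (1 + norm x) powr (-7/4))"
proof -
  obtain J where J: "J \<ge> 0" "\<And>c x. c > 0 \<Longrightarrow>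
      (\<integral>\<^sup>+ y. ennreal ((c + norm (x - y :: vec3)) powr (- (13/4))) \<partial>lborel) \<le> ennreal (J * c powr (3 - 13/4))"
    using nn_integral_decay[of "13/4"] by auto
  show thesis
  proof (rule that[of "4 * J"])
    show "4 * J \<ge> 0" using J by simp
    fix c :: real and x :: vec3
    assume c: "c > 0"
    let ?a = "\<lambda>y. c + norm (x - y)" and ?b = "\<lambda>y::vec3. 1 + norm y" and ?W = "1 + norm x"
    have pw: "?a y powr (-3) * ?b y powr (-2)
        \<le> 4 * ?W powr (-7/4) * (?a y powr (-13/4) + ?b y powr (-13/4))" for y
      using c norm_triangle_ineq[of "x - y" y] by (intro powr_split_le) (auto simp: add_pos_nonneg)
    have "(\<integral>\<^sup>+ y. ennreal (?a y powr (-3) * ?b y powr (-2)) \<partial>lborel)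
        \<le> (\<integral>\<^sup>+ y. ennreal (4 * ?W powr (-7/4)) *
             (ennreal (?a y powr (-13/4)) + ennreal (?b y powr (-13/4))) \<partial>lborel)"
      by (intro nn_integral_mono order.trans[OF ennreal_leI[OF pw]])
         (simp flip: ennreal_plus ennreal_mult)
    also have "\<dots> = ennreal (4 * ?W powr (-7/4)) *
        ((\<integral>\<^sup>+ y. ennreal (?a y powr (-13/4)) \<partial>lborel) + (\<integral>\<^sup>+ y. ennreal (?b y powr (-13/4)) \<partial>lborel))"
      by (simp add: nn_integral_cmult nn_integral_add)
    also have "\<dots> \<le> ennreal (4 * ?W powr (-7/4)) *
        (ennreal (J * c powr (-1/4)) + ennreal (J * 1 powr (-1/4)))"
      using J(2)[OF c, of x] J(2)[of 1 0]
      by (intro mult_left_mono add_mono) (simp_all)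
    also have "\<dots> = ennreal (4 * J * (c powr (-1/4) + 1) * ?W powr (-7/4))"
      using J by (simp add: algebra_simps flip: ennreal_plus ennreal_mult)
    finally show "(\<integral>\<^sup>+ y. ennreal (?a y powr (-3) * ?b y powr (-2)) \<partial>lborel)
        \<le> ennreal (4 * J * (c powr (-1/4) + 1) * ?W powr (-7/4))" .
  qed
qed

lemma nn_integral_powr_singularity:
  fixes t \<kappa> :: real
  assumes "t \<ge> 0" "\<kappa> < 1"
  shows "(\<integral>\<^sup>+ s\<in>{0..t}. ennreal (s powr (- \<kappa>)) \<partial>lborel) = ennreal (t powr (1 - \<kappa>) / (1 - \<kappa>))"
proof -
  have "((\<lambda>s. s powr (- \<kappa>)) has_integral (t powr (- \<kappa> + 1) / (- \<kappa> + 1))) {0..t}"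
    using assms by (intro has_integral_powr_from_0) auto
  then show ?thesis
    using nn_integral_has_integral_lebesgue'[of "{0..t}" "\<lambda>s. s powr (- \<kappa>)"]
    by (simp add: algebra_simps)
qed

lemma nn_integral_powr_singularity_reflected:
  fixes t \<kappa> :: real
  assumes "t \<ge> 0" "\<kappa> < 1"
  shows "(\<integral>\<^sup>+ s\<in>{0..t}. ennreal ((t - s) powr (- \<kappa>)) \<partial>lborel) = ennreal (t powr (1 - \<kappa>) / (1 - \<kappa>))"
  unfolding nn_integral_powr_singularity[OF assms, symmetric]
  by (subst (2) nn_integral_real_affine[where c = "-1" and t = t])
     (auto intro!: nn_integral_cong simp: indicator_def)

section \<open>The Gaussian and its Hessian\<close>

definition gauss :: "vec3 \<Rightarrow> real" where
  "gauss x = exp (- (norm x)\<^sup>2)"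

text \<open>
  The second partial derivative \<open>\<partial>\<^sub>j\<partial>\<^sub>m\<close> of \<open>gauss\<close>.
\<close>

definition gauss_hessian :: "3 \<Rightarrow> 3 \<Rightarrow> vec3 \<Rightarrow> real" where
  "gauss_hessian j m x = (4 * x $ j * x $ m - (if j = m then 2 else 0)) * gauss x"

lemma gauss_weight_bounded:
  fixes r :: real
  assumes "r \<ge> 0"
  shows "(1 + r) ^ n * exp (- r\<^sup>2) \<le> exp ((real n)\<^sup>2)"
proof -
  have "(1 + r) ^ n \<le> exp r ^ n"
    using assms by (intro power_mono exp_ge_add_one_self) auto
  then have "(1 + r) ^ n * exp (- r\<^sup>2) \<le> exp (real n * r) * exp (- r\<^sup>2)"
    by (intro mult_right_mono) (simp_all add: exp_of_nat_mult)
  also have "\<dots> = exp (real n * r - r\<^sup>2)" by (simp flip: exp_add)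
  also have "\<dots> \<le> exp ((real n)\<^sup>2)"
  proof -
    have "0 \<le> (real n - r / 2)\<^sup>2 + 3 / 4 * r\<^sup>2" by simp
    then show ?thesis by (simp add: power2_eq_square algebra_simps)
  qed
  finally show ?thesis .
qed

lemma poly_gauss_decay:
  assumes "A \<le> B * (1 + norm x) ^ k" "B \<ge> 0"
  shows "A * gauss x \<le> B * exp ((real (k + 5))\<^sup>2) / (1 + norm x) ^ 5"
proof -
  have "A * gauss x * (1 + norm x) ^ 5 \<le> B * (1 + norm x) ^ k * gauss x * (1 + norm x) ^ 5"
    using assms by (intro mult_right_mono) (auto simp: gauss_def)
  also have "\<dots> = B * ((1 + norm x) ^ (k + 5) * exp (- (norm x)\<^sup>2))"
    by (simp add: gauss_def power_add mult_ac)
  also have "\<dots> \<le> B * exp ((real (k + 5))\<^sup>2)"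
    using assms by (intro mult_left_mono gauss_weight_bounded) auto
  finally show ?thesis
    by (subst pos_le_divide_eq) (auto simp: add_pos_nonneg)
qed

text \<open>
  Size and local Lipschitz constant both of order \<open>|x|^(-5)\<close>, in a scale-invariant neighbourhood of each
  point. Gaussian profiles decay much faster; the fifth power is what the averages over rays
  below take to reach the decay rates \<open>-3\<close> and \<open>-4\<close> of the Navier--Stokes kernel and of its gradient. A Lipschitz bound is used in place of a gradient bound because it passes
  through integrals without differentiating under the integral sign.
\<close>

definition quintic_decay :: "real \<Rightarrow> (vec3 \<Rightarrow> real) \<Rightarrow> bool" where
  "quintic_decay C \<psi> \<longleftrightarrow> C \<ge> 0 \<and> continuous_on UNIV \<psi> \<and>
     (\<forall>x. \<bar>\<psi> x\<bar> \<le> C / (1 + norm x) ^ 5) \<and>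
     (\<forall>x x'. norm (x' - x) \<le> (1 + norm x) / 2 \<longrightarrow>
        \<bar>\<psi> x' - \<psi> x\<bar> \<le> C * norm (x' - x) / (1 + norm x) ^ 5)"

lemma quintic_decayI:
  assumes der: "\<And>x. (\<psi> has_derivative \<psi>' x) (at x)"
    and B: "B \<ge> 0" "\<And>x. \<bar>\<psi> x\<bar> \<le> B / (1 + norm x) ^ 5"
      "\<And>x h. \<bar>\<psi>' x h\<bar> \<le> B / (1 + norm x) ^ 5 * norm h"
  shows "quintic_decay (32 * B) \<psi>"
  unfolding quintic_decay_def
proof (intro conjI allI impI)
  show "32 * B \<ge> 0" using B by simp
  show "continuous_on UNIV \<psi>"
    using has_derivative_continuous[OF der] by (simp add: continuous_on_eq_continuous_at)
  show "\<bar>\<psi> x\<bar> \<le> 32 * B / (1 + norm x) ^ 5" for x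
    using B(1) order.trans[OF B(2)[of x], of "32 * B / (1 + norm x) ^ 5"]
    by (simp add: divide_right_mono)
  fix x x' :: vec3
  assume near: "norm (x' - x) \<le> (1 + norm x) / 2"
  have "norm (\<psi> x' - \<psi> x) \<le> (32 * B / (1 + norm x) ^ 5) * norm (x' - x)"
  proof (rule differentiable_bound[where f' = \<psi>' and S = "closed_segment x x'"])
    fix u assume "u \<in> closed_segment x x'"
    then have "norm (u - x) \<le> norm (x' - x)"
      using segment_bound(1)[of u x x'] by (simp add: norm_minus_commute)
    then have "(1 + norm x) / 2 \<le> 1 + norm u"
      using near norm_triangle_ineq2[of x u] by (simp add: norm_minus_commute)
    then have "((1 + norm x) / 2) ^ 5 \<le> (1 + norm u) ^ 5"
      by (intro power_mono) auto
    then have "B / (1 + norm u) ^ 5 \<le> B / ((1 + norm x) / 2) ^ 5"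
      using B by (intro divide_left_mono mult_pos_pos zero_less_power) (auto simp: add_pos_nonneg)
    also have "\<dots> = 32 * B / (1 + norm x) ^ 5" by (simp add: power_divide)
    finally have le: "B / (1 + norm u) ^ 5 \<le> 32 * B / (1 + norm x) ^ 5" .
    show "onorm (\<psi>' u) \<le> 32 * B / (1 + norm x) ^ 5"
    proof (rule onorm_le)
      fix h
      have "\<bar>\<psi>' u h\<bar> \<le> B / (1 + norm u) ^ 5 * norm h" by (rule B)
      also have "\<dots> \<le> 32 * B / (1 + norm x) ^ 5 * norm h" by (intro mult_right_mono le) simp
      finally show "norm (\<psi>' u h) \<le> 32 * B / (1 + norm x) ^ 5 * norm h" by simp
    qed
  qed (auto intro: has_derivative_at_withinI der)
  then show "\<bar>\<psi> x' - \<psi> x\<bar> \<le> 32 * B * norm (x' - x) / (1 + norm x) ^ 5" by simp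
qed

lemma has_derivative_gauss:
  "(gauss has_derivative (\<lambda>h. - 2 * (x \<bullet> h) * gauss x)) (at x)"
  unfolding gauss_def power2_norm_eq_inner
  by (rule has_derivative_eq_rhs, (rule derivative_eq_intros refl)+)
     (auto simp: inner_commute algebra_simps)

lemma quintic_decay_gauss: "\<exists>C. quintic_decay C gauss"
proof -
  define B :: real where "B = 2 * exp ((real (1 + 5))\<^sup>2)"
  have "quintic_decay (32 * B) gauss"
  proof (rule quintic_decayI[OF has_derivative_gauss])
    show "B \<ge> 0" by (simp add: B_def)
    show "\<bar>gauss x\<bar> \<le> B / (1 + norm x) ^ 5" for x
      using poly_gauss_decay[of 1 2 x 1] by (simp add: B_def gauss_def)
    show "\<bar>- 2 * (x \<bullet> h) * gauss x\<bar> \<le> B / (1 + norm x) ^ 5 * norm h" for x h :: vec3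
    proof -
      have "\<bar>- 2 * (x \<bullet> h) * gauss x\<bar> = 2 * \<bar>x \<bullet> h\<bar> * gauss x"
        by (simp add: abs_mult gauss_def)
      also have "\<dots> \<le> 2 * (norm x * norm h) * gauss x"
        by (intro mult_mono Cauchy_Schwarz_ineq2) (auto simp: gauss_def)
      also have "\<dots> = (2 * norm x * gauss x) * norm h" by simp
      also have "\<dots> \<le> B / (1 + norm x) ^ 5 * norm h"
        using poly_gauss_decay[of "2 * norm x" 2 x 1]
        by (intro mult_right_mono) (auto simp: B_def)
      finally show ?thesis .
    qed
  qed
  then show ?thesis ..
qed

lemma quintic_decay_gauss_hessian: "\<exists>C. quintic_decay C (gauss_hessian j m)"
proof -
  define \<delta> :: real where "\<delta> = (if j = m then 2 else 0)"
  have \<delta>: "0 \<le> \<delta>" "\<delta> \<le> 2" by (auto simp: \<delta>_def)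
  define B :: real where "B = 16 * exp ((real (3 + 5))\<^sup>2)"
  define \<psi>' where "\<psi>' x h = (4 * (h $ j * x $ m + x $ j * h $ m)
      - 2 * (4 * x $ j * x $ m - \<delta>) * (x \<bullet> h)) * gauss x" for x h :: vec3
  have comp: "\<bar>u $ i\<bar> \<le> norm u" for u :: vec3 and i by (rule component_le_norm_cart)
  have quad: "\<bar>4 * x $ j * x $ m - \<delta>\<bar> \<le> 4 * (1 + norm x) ^ 2" for x :: vec3
  proof -
    have "\<bar>x $ j * x $ m\<bar> \<le> norm x * norm x"
      unfolding abs_mult by (intro mult_mono comp) auto
    then have "\<bar>4 * x $ j * x $ m - \<delta>\<bar> \<le> 4 * (norm x * norm x) + 2" using \<delta> by linarith
    also have "\<dots> \<le> 4 * (1 + norm x) ^ 2" by (simp add: power2_eq_square algebra_simps)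
    finally show ?thesis .
  qed
  have "quintic_decay (32 * B) (gauss_hessian j m)"
  proof (rule quintic_decayI)
    show "(gauss_hessian j m has_derivative \<psi>' x) (at x)" for x
      unfolding gauss_hessian_def \<psi>'_def \<delta>_def[symmetric]
      by (rule has_derivative_eq_rhs,
          (rule derivative_eq_intros has_derivative_gauss bounded_linear.has_derivative[OF bounded_linear_vec_nth] refl)+)
         (auto simp: algebra_simps)
    show "B \<ge> 0" by (simp add: B_def)
    show "\<bar>gauss_hessian j m x\<bar> \<le> B / (1 + norm x) ^ 5" for x
    proof -
      have "\<bar>gauss_hessian j m x\<bar> = \<bar>4 * x $ j * x $ m - \<delta>\<bar> * gauss x"
        by (simp add: gauss_hessian_def abs_mult gauss_def \<delta>_def)
      also have "\<dots> \<le> B / (1 + norm x) ^ 5"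
        unfolding B_def
      proof (rule poly_gauss_decay)
        show "\<bar>4 * x $ j * x $ m - \<delta>\<bar> \<le> 16 * (1 + norm x) ^ 3"
          using quad[of x] power_increasing[of 2 3 "1 + norm x"] by simp
      qed simp
      finally show ?thesis .
    qed
    show "\<bar>\<psi>' x h\<bar> \<le> B / (1 + norm x) ^ 5 * norm h" for x h
    proof -
      have "\<bar>h $ j * x $ m\<bar> \<le> norm h * norm x" "\<bar>x $ j * h $ m\<bar> \<le> norm x * norm h"
        unfolding abs_mult by (intro mult_mono comp; simp)+
      then have 1: "\<bar>4 * (h $ j * x $ m + x $ j * h $ m)\<bar> \<le> 8 * norm x * norm h"
        by (simp add: mult.commute[of "norm h" "norm x"] mult.assoc)
      have 2: "\<bar>2 * (4 * x $ j * x $ m - \<delta>) * (x \<bullet> h)\<bar> \<le> (2 * (4 * (1 + norm x) ^ 2)) * (norm x * norm h)"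
        unfolding abs_mult by (intro mult_mono quad Cauchy_Schwarz_ineq2) (auto intro: quad)
      have "\<bar>\<psi>' x h\<bar> \<le> (8 * norm x * norm h + (2 * (4 * (1 + norm x) ^ 2)) * (norm x * norm h)) * gauss x"
        unfolding \<psi>'_def abs_mult
        using 1 2 by (intro mult_mono) (auto simp: gauss_def)
      also have "\<dots> = (8 * norm x + 8 * (1 + norm x) ^ 2 * norm x) * gauss x * norm h"
        by (simp add: algebra_simps)
      also have "\<dots> \<le> B / (1 + norm x) ^ 5 * norm h"
        unfolding B_def
      proof (intro mult_right_mono poly_gauss_decay)
        have "8 * norm x \<le> 8 * (1 + norm x) ^ 3"
          using power_increasing[of 1 3 "1 + norm x"] by simp
        moreover have "8 * (1 + norm x) ^ 2 * norm x \<le> 8 * (1 + norm x) ^ 2 * (1 + norm x)"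
          by (intro mult_left_mono) auto
        ultimately show "8 * norm x + 8 * (1 + norm x) ^ 2 * norm x \<le> 16 * (1 + norm x) ^ 3"
          by (simp add: power3_eq_cube power2_eq_square)
      qed auto
      finally show ?thesis .
    qed
  qed
  then show ?thesis ..
qed

section \<open>Averages over rays\<close>

text \<open>
  The primitive is \<open>(\<theta> / (1 + \<theta> r))^(n+1) / (n + 1)\<close>.
\<close>

lemma has_integral_ray_weight:
  fixes r :: real
  assumes "r \<ge> 0"
  shows "((\<lambda>\<theta>. \<theta> ^ n / (1 + \<theta> * r) ^ (n + 2)) has_integral 1 / (real (n + 1) * (1 + r) ^ (n + 1))) {0..1}"
proof -
  have pos: "1 + \<theta> * r > 0" if "\<theta> \<ge> 0" for \<theta>
    using assms that by (simp add: add_pos_nonneg)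
  have "((\<lambda>\<theta>. (\<theta> / (1 + \<theta> * r)) ^ (n + 1) / real (n + 1)) has_real_derivative
          \<theta> ^ n / (1 + \<theta> * r) ^ (n + 2)) (at \<theta> within {0..1})" if "\<theta> \<in> {0..1}" for \<theta>
  proof -
    have p: "1 + \<theta> * r > 0" using pos that by simp
    have "((\<lambda>\<theta>. \<theta> / (1 + \<theta> * r)) has_real_derivative 1 / (1 + \<theta> * r)\<^sup>2) (at \<theta> within {0..1})"
      using p by (auto intro!: derivative_eq_intros simp: field_simps power2_eq_square)
    from DERIV_cdivide[OF DERIV_power[OF this, of "n + 1"], of "real (n + 1)"]
    have "((\<lambda>\<theta>. (\<theta> / (1 + \<theta> * r)) ^ (n + 1) / real (n + 1)) has_real_derivative
        (\<theta> / (1 + \<theta> * r)) ^ n * (1 / (1 + \<theta> * r)\<^sup>2)) (at \<theta> within {0..1})"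
      by (simp add: mult_ac)
    then show ?thesis by (simp add: power_divide power_add power2_eq_square mult_ac)
  qed
  then have "((\<lambda>\<theta>. \<theta> ^ n / (1 + \<theta> * r) ^ (n + 2)) has_integral
      (1 / (1 + 1 * r)) ^ (n + 1) / real (n + 1) - (0 / (1 + 0 * r)) ^ (n + 1) / real (n + 1)) {0..1}"
    by (intro fundamental_theorem_of_calculus)
       (auto simp: has_real_derivative_iff_has_vector_derivative)
  then show ?thesis by (simp add: power_divide mult.commute)
qed

text \<open>
  The function \<open>kernel_potential\<close> is a superposition of Gaussians of all widths larger than the
  diffusion length; after rescaling, its Hessian is the average of \<open>gauss_hessian\<close> along the segment from
  \<open>0\<close> to \<open>x\<close> with weight \<open>\<theta>\<^sup>2\<close>.
\<close>

definition ray_average :: "(vec3 \<Rightarrow> real) \<Rightarrow> vec3 \<Rightarrow> real" where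
  "ray_average \<psi> x = integral {0..1} (\<lambda>\<theta>. \<theta>\<^sup>2 * \<psi> (\<theta> *\<^sub>R x))"

text \<open>
  Averaging along the ray costs decay because points with small \<open>\<theta>\<close> stay near the origin, where the profile is not
  small: the weights \<open>\<theta>\<^sup>2\<close> for the size, and \<open>\<theta>\<^sup>3\<close> for the differences (one more factor from
  \<open>|\<theta>x' - \<theta>x|\<close>), determine the surviving powers \<open>-3\<close> and \<open>-4\<close>.
\<close>

lemma ray_average_decay:
  assumes "quintic_decay C \<psi>"
  shows "\<bar>ray_average \<psi> x\<bar> \<le> C / (1 + norm x) ^ 3"
    and "norm (x' - x) \<le> (1 + norm x) / 2 \<Longrightarrow>
      \<bar>ray_average \<psi> x' - ray_average \<psi> x\<bar> \<le> C * norm (x' - x) / (1 + norm x) ^ 4"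
proof -
  have C: "C \<ge> 0" and cont: "continuous_on UNIV \<psi>"
    and bd: "\<And>x. \<bar>\<psi> x\<bar> \<le> C / (1 + norm x) ^ 5"
    and lip: "\<And>x x'. norm (x' - x) \<le> (1 + norm x) / 2 \<Longrightarrow>
        \<bar>\<psi> x' - \<psi> x\<bar> \<le> C * norm (x' - x) / (1 + norm x) ^ 5"
    using assms by (auto simp: quintic_decay_def)
  have int: "(\<lambda>\<theta>. \<theta>\<^sup>2 * \<psi> (\<theta> *\<^sub>R x)) integrable_on {0..1}" for x
    by (intro integrable_continuous_real continuous_intros continuous_on_compose2[OF cont]) auto
  note I = has_integral_ray_weight[OF norm_ge_zero[of x]]
  have "norm (integral {0..1} (\<lambda>\<theta>. \<theta>\<^sup>2 * \<psi> (\<theta> *\<^sub>R x)))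
      \<le> integral {0..1} (\<lambda>\<theta>. C * (\<theta> ^ 2 / (1 + \<theta> * norm x) ^ (2 + 2)))"
  proof (rule integral_norm_bound_integral[OF int])
    show "(\<lambda>\<theta>. C * (\<theta> ^ 2 / (1 + \<theta> * norm x) ^ (2 + 2))) integrable_on {0..1}"
      by (rule has_integral_integrable[OF has_integral_mult_right[OF I[of 2]]])
    fix \<theta> :: real assume \<theta>: "\<theta> \<in> {0..1}"
    then have 1: "1 + \<theta> * norm x \<ge> 1" by simp
    have "\<bar>\<psi> (\<theta> *\<^sub>R x)\<bar> \<le> C / (1 + \<theta> * norm x) ^ 5" using bd[of "\<theta> *\<^sub>R x"] \<theta> by simp
    also have "\<dots> \<le> C / (1 + \<theta> * norm x) ^ 4"
      using C 1 by (intro divide_left_mono power_increasing mult_pos_pos zero_less_power) auto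
    finally show "norm (\<theta>\<^sup>2 * \<psi> (\<theta> *\<^sub>R x)) \<le> C * (\<theta> ^ 2 / (1 + \<theta> * norm x) ^ (2 + 2))"
      using mult_left_mono[of "\<bar>\<psi> (\<theta> *\<^sub>R x)\<bar>" "C / (1 + \<theta> * norm x) ^ 4" "\<theta>\<^sup>2"]
      by (simp add: abs_mult mult_ac)
  qed
  also have "\<dots> = C * (1 / (3 * (1 + norm x) ^ 3))"
    using integral_unique[OF has_integral_mult_right[OF I[of 2], of C]] by simp
  also have "\<dots> \<le> C / (1 + norm x) ^ 3"
  proof -
    have "C * (1 / (3 * (1 + norm x) ^ 3)) = C / (1 + norm x) ^ 3 / 3" by simp
    then show ?thesis using divide_nonneg_nonneg[OF C, of "(1 + norm x) ^ 3"] by simp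
  qed
  finally show "\<bar>ray_average \<psi> x\<bar> \<le> C / (1 + norm x) ^ 3"
    by (simp add: ray_average_def)
  assume near: "norm (x' - x) \<le> (1 + norm x) / 2"
  have "norm (integral {0..1} (\<lambda>\<theta>. \<theta>\<^sup>2 * \<psi> (\<theta> *\<^sub>R x') - \<theta>\<^sup>2 * \<psi> (\<theta> *\<^sub>R x)))
      \<le> integral {0..1} (\<lambda>\<theta>. C * norm (x' - x) * (\<theta> ^ 3 / (1 + \<theta> * norm x) ^ (3 + 2)))"
  proof (rule integral_norm_bound_integral[OF integrable_diff[OF int int]])
    show "(\<lambda>\<theta>. C * norm (x' - x) * (\<theta> ^ 3 / (1 + \<theta> * norm x) ^ (3 + 2))) integrable_on {0..1}"
      by (rule has_integral_integrable[OF has_integral_mult_right[OF I[of 3]]])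
    fix \<theta> :: real assume \<theta>: "\<theta> \<in> {0..1}"
    have "norm (\<theta> *\<^sub>R x' - \<theta> *\<^sub>R x) = \<theta> * norm (x' - x)"
      using \<theta> by (simp flip: scaleR_diff_right)
    moreover have "\<theta> * norm (x' - x) \<le> (1 + norm (\<theta> *\<^sub>R x)) / 2"
      using mult_left_mono[OF near, of \<theta>] \<theta> by (simp add: algebra_simps)
    ultimately have "\<bar>\<psi> (\<theta> *\<^sub>R x') - \<psi> (\<theta> *\<^sub>R x)\<bar> \<le> C * (\<theta> * norm (x' - x)) / (1 + \<theta> * norm x) ^ 5"
      using lip[of "\<theta> *\<^sub>R x'" "\<theta> *\<^sub>R x"] \<theta> by simp
    then have "\<theta>\<^sup>2 * \<bar>\<psi> (\<theta> *\<^sub>R x') - \<psi> (\<theta> *\<^sub>R x)\<bar> \<le> \<theta>\<^sup>2 * (C * (\<theta> * norm (x' - x)) / (1 + \<theta> * norm x) ^ 5)"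
      by (rule mult_left_mono) simp
    then show "norm (\<theta>\<^sup>2 * \<psi> (\<theta> *\<^sub>R x') - \<theta>\<^sup>2 * \<psi> (\<theta> *\<^sub>R x))
        \<le> C * norm (x' - x) * (\<theta> ^ 3 / (1 + \<theta> * norm x) ^ (3 + 2))"
      by (simp add: abs_mult power3_eq_cube power2_eq_square mult_ac flip: right_diff_distrib)
  qed
  also have "\<dots> = C * norm (x' - x) * (1 / (4 * (1 + norm x) ^ 4))"
    using integral_unique[OF has_integral_mult_right[OF I[of 3], of "C * norm (x' - x)"]] by simp
  also have "\<dots> \<le> C * norm (x' - x) / (1 + norm x) ^ 4"
  proof -
    have "C * norm (x' - x) * (1 / (4 * (1 + norm x) ^ 4)) = C * norm (x' - x) / (1 + norm x) ^ 4 / 4"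
      by simp
    then show ?thesis
      using divide_nonneg_nonneg[OF mult_nonneg_nonneg[OF C norm_ge_zero[of "x' - x"]],
          of "(1 + norm x) ^ 4"] by simp
  qed
  finally show "\<bar>ray_average \<psi> x' - ray_average \<psi> x\<bar> \<le> C * norm (x' - x) / (1 + norm x) ^ 4"
    by (simp add: ray_average_def integral_diff int)
qed

section \<open>The Navier--Stokes kernel as a rescaled ray average\<close>

definition gauss_moment :: "nat \<Rightarrow> real \<Rightarrow> real" where
  "gauss_moment k q = integral {0..1} (\<lambda>\<theta>. \<theta> ^ (2 * k) * exp (- (\<theta>\<^sup>2 * q)))"

lemma gauss_moment_integrable:
  "(\<lambda>\<theta>. \<theta> ^ (2 * k) * exp (- (\<theta>\<^sup>2 * q))) integrable_on {0..1::real}"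
  by (intro integrable_continuous_real continuous_intros)

text \<open>
  Differentiation under the integral sign is confined to this one-dimensional family, to which all
  derivatives of the potential reduce by the chain rule.
\<close>

lemma DERIV_gauss_moment:
  "(gauss_moment k has_real_derivative - gauss_moment (Suc k) q) (at q)"
proof -
  let ?f = "\<lambda>q \<theta>. \<theta> ^ (2 * k) * exp (- (\<theta>\<^sup>2 * q)) :: real"
  let ?f' = "\<lambda>q \<theta>. - (\<theta> ^ (2 * Suc k) * exp (- (\<theta>\<^sup>2 * q))) :: real"
  have "((\<lambda>q. integral (cbox 0 1) (?f q)) has_field_derivative integral (cbox 0 1) (?f' q)) (at q within UNIV)"
  proof (rule leibniz_rule_field_derivative)
    show "((\<lambda>q. ?f q \<theta>) has_field_derivative ?f' q \<theta>) (at q within UNIV)" for q \<theta>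
      by (auto intro!: derivative_eq_intros simp: power2_eq_square)
    show "?f q integrable_on cbox 0 1" for q
      using gauss_moment_integrable by simp
    show "continuous_on (UNIV \<times> cbox 0 1) (\<lambda>(q, \<theta>). ?f' q \<theta>)"
      unfolding case_prod_beta by (intro continuous_intros)
  qed auto
  then show ?thesis
    unfolding gauss_moment_def[abs_def] by simp
qed

text \<open>
  The substitution \<open>s = \<theta> |x| / \<surd>(4\<nu>t)\<close> turns the error function integral into one over a fixed
  interval and removes the apparent singularity at \<open>x = 0\<close>.
\<close>

lemma kernel_potential_eq_moment:
  assumes "\<nu> > 0" "t > 0"
  shows "kernel_potential \<nu> t x = (1 / sqrt (4 * \<nu> * t)) * gauss_moment 0 ((norm x)\<^sup>2 / (4 * \<nu> * t))"
proof (cases "x = 0")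
  case True
  then show ?thesis by (simp add: kernel_potential_def gauss_moment_def)
next
  case False
  define r where "r = norm x / sqrt (4 * \<nu> * t)"
  have r: "r > 0" using False assms by (simp add: r_def)
  have r2: "(norm x)\<^sup>2 / (4 * \<nu> * t) = r\<^sup>2"
    using assms by (simp add: r_def power_divide)
  have "((\<lambda>s. exp (- s\<^sup>2)) has_integral integral {0..r} (\<lambda>s. exp (- s\<^sup>2))) {0..r}"
    by (auto intro!: integrable_integral integrable_continuous_real continuous_intros)
  from has_integral_stretch_real[OF this, of r]
  have "((\<lambda>\<theta>. exp (- (\<theta>\<^sup>2 * r\<^sup>2))) has_integral integral {0..r} (\<lambda>s. exp (- s\<^sup>2)) / r) {0..1}"
    using r by (simp add: power_mult_distrib mult.commute)
  from integral_unique[OF this]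
  have "integral {0..r} (\<lambda>s. exp (- s\<^sup>2)) = r * gauss_moment 0 (r\<^sup>2)"
    using r by (simp add: gauss_moment_def field_simps)
  then show ?thesis
    using False r by (simp add: kernel_potential_def r2 flip: r_def) (simp add: r_def)
qed

lemma partial_deriv_radial:
  assumes "(F has_real_derivative F') (at ((norm x)\<^sup>2 / d))"
  shows "((\<lambda>r. F ((norm (x + r *\<^sub>R axis m 1 :: vec3))\<^sup>2 / d)) has_real_derivative F' * (2 * x $ m / d)) (at 0)"
proof -
  have eq: "(norm (x + r *\<^sub>R axis m 1))\<^sup>2 = (norm x)\<^sup>2 + 2 * r * x $ m + r\<^sup>2" for r
    unfolding power2_norm_eq_inner
    by (simp add: inner_axis inner_axis' inner_add_left inner_add_right power2_eq_square algebra_simps)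
  have "((\<lambda>r. ((norm x)\<^sup>2 + 2 * r * x $ m + r\<^sup>2) / d) has_real_derivative 2 * x $ m / d) (at 0)"
    by (rule DERIV_cdivide) (auto intro!: derivative_eq_intros)
  from DERIV_chain2[of F F' "\<lambda>r. ((norm x)\<^sup>2 + 2 * r * x $ m + r\<^sup>2) / d", OF _ this] assms
  show ?thesis by (simp add: eq)
qed

lemma partial_deriv_kernel_potential:
  assumes "\<nu> > 0" "t > 0"
  defines "d \<equiv> 4 * \<nu> * t"
  shows "partial_deriv j (partial_deriv m (kernel_potential \<nu> t)) x
    = (4 * x $ j * x $ m / d\<^sup>2 * gauss_moment 2 ((norm x)\<^sup>2 / d)
       - (if j = m then 2 / d else 0) * gauss_moment 1 ((norm x)\<^sup>2 / d)) / sqrt d"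
proof -
  have "d > 0" using assms by (simp add: d_def)
  have first: "partial_deriv m (kernel_potential \<nu> t) x
      = - (2 * x $ m / d) * gauss_moment 1 ((norm x)\<^sup>2 / d) / sqrt d" for x
    unfolding partial_deriv_def kernel_potential_eq_moment[OF assms(1,2)] d_def[symmetric]
    using DERIV_cmult[OF partial_deriv_radial[OF DERIV_gauss_moment[of 0 "(norm x)\<^sup>2 / d"], of m],
        of "1 / sqrt d"]
    by (intro DERIV_imp_deriv) (simp add: mult_ac)
  have coord: "((\<lambda>r. (x + r *\<^sub>R axis j 1) $ m) has_real_derivative (if j = m then 1 else 0)) (at 0)"
    by (auto simp: axis_def intro!: derivative_eq_intros)
  note moment = partial_deriv_radial[OF DERIV_gauss_moment[of 1 "(norm x)\<^sup>2 / d"], of j]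
  have "((\<lambda>r. - (2 * (x + r *\<^sub>R axis j 1) $ m / d)
        * gauss_moment 1 ((norm (x + r *\<^sub>R axis j 1))\<^sup>2 / d) / sqrt d) has_real_derivative
      (4 * x $ j * x $ m / d\<^sup>2 * gauss_moment 2 ((norm x)\<^sup>2 / d)
       - (if j = m then 2 / d else 0) * gauss_moment 1 ((norm x)\<^sup>2 / d)) / sqrt d) (at 0)"
    using DERIV_cmult[OF DERIV_mult[OF coord moment], of "- 2 / d / sqrt d"]
    by (rule DERIV_cong[THEN back_subst[of "\<lambda>f. (f has_real_derivative _) (at 0)"]])
       (use \<open>d > 0\<close> in \<open>auto simp: power2_eq_square numeral_2_eq_2 field_simps\<close>)
  then show ?thesis
    unfolding partial_deriv_def[of j] first by (rule DERIV_imp_deriv)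
qed

lemma ray_average_gauss_hessian:
  "ray_average (gauss_hessian j m) x
    = 4 * x $ j * x $ m * gauss_moment 2 ((norm x)\<^sup>2) - (if j = m then 2 else 0) * gauss_moment 1 ((norm x)\<^sup>2)"
proof -
  have "ray_average (gauss_hessian j m) x = integral {0..1} (\<lambda>\<theta>.
      4 * x $ j * x $ m * (\<theta> ^ (2 * 2) * exp (- (\<theta>\<^sup>2 * (norm x)\<^sup>2)))
      - (if j = m then 2 else 0) * (\<theta> ^ (2 * 1) * exp (- (\<theta>\<^sup>2 * (norm x)\<^sup>2))))"
    unfolding ray_average_def
    by (intro integral_cong)
       (simp add: gauss_hessian_def gauss_def power_mult_distrib algebra_simps eval_nat_numeral)
  also have "\<dots> = 4 * x $ j * x $ m * gauss_moment 2 ((norm x)\<^sup>2)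
      - (if j = m then 2 else 0) * gauss_moment 1 ((norm x)\<^sup>2)"
    unfolding gauss_moment_def
    by (intro integral_unique has_integral_diff has_integral_mult_right integrable_integral
        gauss_moment_integrable)
  finally show ?thesis .
qed

definition diffusion_length :: "real \<Rightarrow> real \<Rightarrow> real" where
  "diffusion_length \<nu> t = sqrt (4 * \<nu> * t)"

text \<open>
  Both kernels are \<open>c^(-3)\<close> times a fixed profile evaluated at \<open>x / c\<close>, where \<open>c\<close> is the diffusion length,
  so it suffices to bound profiles at unit scale.
\<close>

lemma heat_kernel_scaling:
  assumes "\<nu> > 0" "t > 0"
  defines "c \<equiv> diffusion_length \<nu> t"
  shows "heat_kernel \<nu> x t = pi powr (-3/2) / c ^ 3 * gauss ((1 / c) *\<^sub>R x)"
proof -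
  have c: "c > 0" and c2: "c\<^sup>2 = 4 * \<nu> * t"
    using assms by (simp_all add: c_def diffusion_length_def)
  have "(c\<^sup>2) powr (3 / 2) = (c powr 2) powr (3 / 2)" using c by simp
  also have "\<dots> = c powr 3" by (subst powr_powr) simp
  finally have "(c\<^sup>2 * pi) powr (3 / 2) = c ^ 3 * pi powr (3 / 2)"
    using c by (simp add: powr_mult)
  note volume = this
  show ?thesis
    unfolding heat_kernel_def c2[symmetric] volume
    using c by (simp add: gauss_def power_mult_distrib power_divide powr_minus field_simps)
qed

lemma NS_kernel_scaling:
  assumes "\<nu> > 0" "t > 0"
  defines "c \<equiv> diffusion_length \<nu> t"
  shows "NS_kernel \<nu> x t $ j $ m = (if j = m then heat_kernel \<nu> x t else 0)
    + 1 / (2 * pi powr (3/2)) / c ^ 3 * ray_average (gauss_hessian j m) ((1 / c) *\<^sub>R x)"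
proof -
  have c: "c > 0" and c2: "c\<^sup>2 = 4 * \<nu> * t" and sq: "sqrt (4 * \<nu> * t) = c"
    using assms by (simp_all add: c_def diffusion_length_def)
  have "partial_deriv j (partial_deriv m (kernel_potential \<nu> t)) x
      = ray_average (gauss_hessian j m) ((1 / c) *\<^sub>R x) / c ^ 3"
    unfolding partial_deriv_kernel_potential[OF assms(1,2)] ray_average_gauss_hessian
      c2[symmetric]
    using c by (simp add: power_divide power_mult_distrib field_simps) (simp add: eval_nat_numeral)?
  then show ?thesis by (simp add: NS_kernel_def)
qed

section \<open>Kernel bounds\<close>

lemma norm_matrix_vector_le_entries:
  fixes M :: "real ^ 3 ^ 3"
  assumes "\<And>j m. \<bar>M $ j $ m\<bar> \<le> B"
  shows "norm (M *v w) \<le> 9 * B * norm w"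
proof -
  have "\<bar>(M *v w) $ j\<bar> \<le> 3 * B * norm w" for j
  proof -
    have "\<bar>(M *v w) $ j\<bar> \<le> (\<Sum>m\<in>UNIV. \<bar>M $ j $ m * w $ m\<bar>)"
      unfolding matrix_vector_mult_def by (simp add: sum_abs)
    also have "\<dots> \<le> (\<Sum>m\<in>(UNIV::3 set). B * norm w)"
      unfolding abs_mult
      by (intro sum_mono mult_mono assms component_le_norm_cart)
         (use assms[of j j] in \<open>auto intro: order.trans[OF abs_ge_zero]\<close>)
    finally show ?thesis by simp
  qed
  then have "(\<Sum>j\<in>UNIV. \<bar>(M *v w) $ j\<bar>) \<le> (\<Sum>j\<in>(UNIV::3 set). 3 * B * norm w)"
    by (rule sum_mono)
  then show ?thesis using norm_le_l1_cart[of "M *v w"] by simp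
qed

lemma diffusion_length_pos: "\<nu> > 0 \<Longrightarrow> t > 0 \<Longrightarrow> diffusion_length \<nu> t > 0"
  by (simp add: diffusion_length_def)

lemma scaled_weight:
  assumes "c > 0"
  shows "1 / c ^ k / (1 + norm ((1 / c) *\<^sub>R z)) ^ k = (c + norm z) powr (- real k)"
proof -
  have "1 + norm ((1 / c) *\<^sub>R z) = (c + norm z) / c" using assms by (simp add: field_simps)
  then have "1 / c ^ k / (1 + norm ((1 / c) *\<^sub>R z)) ^ k = 1 / (c + norm z) ^ k"
    using assms by (simp add: power_divide)
  also have "\<dots> = (c + norm z) powr (- real k)"
    using assms by (simp add: powr_minus powr_realpow add_pos_nonneg divide_inverse)
  finally show ?thesis .
qed

lemma scaled_near:
  assumes "c > 0" "norm (z' - z) \<le> (c + norm z) / 2"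
  shows "norm ((1 / c) *\<^sub>R z' - (1 / c) *\<^sub>R z) = norm (z' - z) / c"
    and "norm ((1 / c) *\<^sub>R z' - (1 / c) *\<^sub>R z) \<le> (1 + norm ((1 / c) *\<^sub>R z)) / 2"
proof -
  show 1: "norm ((1 / c) *\<^sub>R z' - (1 / c) *\<^sub>R z) = norm (z' - z) / c"
    using assms by (simp flip: scaleR_diff_right)
  show "norm ((1 / c) *\<^sub>R z' - (1 / c) *\<^sub>R z) \<le> (1 + norm ((1 / c) *\<^sub>R z)) / 2"
    unfolding 1 using assms by (simp add: field_simps)
qed

text \<open>
  The heat kernel keeps an extra factor \<open>c / (c + |z|)\<close> compared with the Navier--Stokes kernel. This makes
  it integrable uniformly in time, which is what allows bounds for the heat flow up to \<open>t = 0\<close>.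
\<close>

lemma heat_kernel_bounds:
  obtains C where "C \<ge> 0"
    "\<And>\<nu> t z. \<nu> > 0 \<Longrightarrow> t > 0 \<Longrightarrow> \<bar>heat_kernel \<nu> z t\<bar>
       \<le> C * diffusion_length \<nu> t * (diffusion_length \<nu> t + norm z) powr (-4)"
    "\<And>\<nu> t z z'. \<nu> > 0 \<Longrightarrow> t > 0 \<Longrightarrow> norm (z' - z) \<le> (diffusion_length \<nu> t + norm z) / 2 \<Longrightarrow>
       \<bar>heat_kernel \<nu> z' t - heat_kernel \<nu> z t\<bar>
       \<le> C * norm (z' - z) * (diffusion_length \<nu> t + norm z) powr (-4)"
proof -
  obtain C where Q: "quintic_decay C gauss" using quintic_decay_gauss by blast
  define k :: real where "k = pi powr (-3/2)"
  have C: "C \<ge> 0" and k: "k \<ge> 0" using Q by (auto simp: quintic_decay_def k_def)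
  have weaken: "A / (1 + norm x) ^ 5 \<le> A / (1 + norm x) ^ 4" if "A \<ge> 0" for A :: real and x :: vec3
    using that by (intro divide_left_mono power_increasing mult_pos_pos zero_less_power)
      (auto simp: add_pos_nonneg)
  show thesis
  proof (rule that[of "k * C"])
    show "k * C \<ge> 0" using k C by simp
    fix \<nu> t :: real and z :: vec3
    assume "\<nu> > 0" "t > 0"
    define c where "c = diffusion_length \<nu> t"
    have c: "c > 0" using \<open>\<nu> > 0\<close> \<open>t > 0\<close> by (simp add: c_def diffusion_length_pos)
    note scaling = heat_kernel_scaling[OF \<open>\<nu> > 0\<close> \<open>t > 0\<close>, folded c_def k_def]
    let ?\<eta> = "\<lambda>z. (1 / c) *\<^sub>R z :: vec3"
    have "\<bar>gauss (?\<eta> z)\<bar> \<le> C / (1 + norm (?\<eta> z)) ^ 4"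
      using Q weaken[OF C, of "?\<eta> z"] unfolding quintic_decay_def by (meson order.trans)
    then have "k / c ^ 3 * \<bar>gauss (?\<eta> z)\<bar> \<le> k / c ^ 3 * (C / (1 + norm (?\<eta> z)) ^ 4)"
      using k c by (intro mult_left_mono) auto
    also have "\<dots> = k * C * c * (1 / c ^ 4 / (1 + norm (?\<eta> z)) ^ 4)"
      using c by (simp add: eval_nat_numeral)
    also have "\<dots> = k * C * c * (c + norm z) powr (-4)"
      using scaled_weight[OF c, of 4 z] by simp
    finally show "\<bar>heat_kernel \<nu> z t\<bar> \<le> k * C * diffusion_length \<nu> t * (diffusion_length \<nu> t + norm z) powr (-4)"
      using k c by (simp add: scaling abs_mult flip: c_def)
    fix z' :: vec3
    assume "norm (z' - z) \<le> (diffusion_length \<nu> t + norm z) / 2"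
    note near = scaled_near[OF c this[folded c_def]]
    have "\<bar>gauss (?\<eta> z') - gauss (?\<eta> z)\<bar> \<le> C * (norm (z' - z) / c) / (1 + norm (?\<eta> z)) ^ 5"
      using Q near unfolding quintic_decay_def by metis
    also have "\<dots> \<le> C * (norm (z' - z) / c) / (1 + norm (?\<eta> z)) ^ 4"
      using C c by (intro weaken) auto
    finally have "k / c ^ 3 * \<bar>gauss (?\<eta> z') - gauss (?\<eta> z)\<bar>
        \<le> k / c ^ 3 * (C * (norm (z' - z) / c) / (1 + norm (?\<eta> z)) ^ 4)"
      using k c by (intro mult_left_mono) auto
    also have "\<dots> = k * C * norm (z' - z) * (1 / c ^ 4 / (1 + norm (?\<eta> z)) ^ 4)"
      by (simp add: eval_nat_numeral mult_ac)
    also have "\<dots> = k * C * norm (z' - z) * (c + norm z) powr (-4)"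
      using scaled_weight[OF c, of 4 z] by simp
    finally have "\<bar>k / c ^ 3 * (gauss (?\<eta> z') - gauss (?\<eta> z))\<bar> \<le> k * C * norm (z' - z) * (c + norm z) powr (-4)"
      using k c by (simp add: abs_mult)
    then show "\<bar>heat_kernel \<nu> z' t - heat_kernel \<nu> z t\<bar>
        \<le> k * C * norm (z' - z) * (diffusion_length \<nu> t + norm z) powr (-4)"
      unfolding scaling right_diff_distrib c_def .
  qed
qed

text \<open>
  The power \<open>-3\<close> is sharp: the nonlocal part created by the pressure does not decay like a Gaussian. The
  constant is independent of \<open>\<nu>\<close>, which enters only through the diffusion length.
\<close>

lemma NS_kernel_bounds:
  obtains C where "C \<ge> 0"
    "\<And>\<nu> t z w. \<nu> > 0 \<Longrightarrow> t > 0 \<Longrightarrow> norm (NS_kernel \<nu> z t *v w)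
       \<le> C * (diffusion_length \<nu> t + norm z) powr (-3) * norm w"
    "\<And>\<nu> t z z' w. \<nu> > 0 \<Longrightarrow> t > 0 \<Longrightarrow> norm (z' - z) \<le> (diffusion_length \<nu> t + norm z) / 2 \<Longrightarrow>
       norm (NS_kernel \<nu> z' t *v w - NS_kernel \<nu> z t *v w)
       \<le> C * norm (z' - z) * (diffusion_length \<nu> t + norm z) powr (-4) * norm w"
proof -
  obtain D where D: "D \<ge> 0"
    and heat: "\<And>\<nu> t z. \<nu> > 0 \<Longrightarrow> t > 0 \<Longrightarrow> \<bar>heat_kernel \<nu> z t\<bar>
       \<le> D * diffusion_length \<nu> t * (diffusion_length \<nu> t + norm z) powr (-4)"
    and heat': "\<And>\<nu> t z z'. \<nu> > 0 \<Longrightarrow> t > 0 \<Longrightarrow> norm (z' - z) \<le> (diffusion_length \<nu> t + norm z) / 2 \<Longrightarrow>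
       \<bar>heat_kernel \<nu> z' t - heat_kernel \<nu> z t\<bar>
       \<le> D * norm (z' - z) * (diffusion_length \<nu> t + norm z) powr (-4)"
    by (rule heat_kernel_bounds) blast
  obtain A where A: "\<And>j m. quintic_decay (A j m) (gauss_hessian j m)"
    using quintic_decay_gauss_hessian by metis
  define k :: real where "k = 1 / (2 * pi powr (3/2))"
  define H where "H = (\<Sum>j\<in>UNIV. \<Sum>m\<in>UNIV. A j m)"
  have k: "k \<ge> 0" by (simp add: k_def)
  have A0: "A j m \<ge> 0" for j m using A[of j m] by (simp add: quintic_decay_def)
  have AH: "A j m \<le> H" for j m
  proof -
    have "A j m \<le> (\<Sum>m\<in>UNIV. A j m)" by (intro member_le_sum A0) auto
    also have "\<dots> \<le> H" unfolding H_def
      by (intro member_le_sum[of j UNIV "\<lambda>j. \<Sum>m\<in>UNIV. A j m"] sum_nonneg A0) auto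
    finally show ?thesis .
  qed
  have H: "H \<ge> 0" using AH[of 0 0] A0[of 0 0] by simp
  show thesis
  proof (rule that[of "9 * (D + k * H)"])
    show "9 * (D + k * H) \<ge> 0" using D k H by simp
    fix \<nu> t :: real and z w :: vec3
    assume "\<nu> > 0" "t > 0"
    define c where "c = diffusion_length \<nu> t"
    have c: "c > 0" using \<open>\<nu> > 0\<close> \<open>t > 0\<close> by (simp add: c_def diffusion_length_pos)
    note scaling = NS_kernel_scaling[OF \<open>\<nu> > 0\<close> \<open>t > 0\<close>, folded c_def k_def]
    let ?\<eta> = "\<lambda>z. (1 / c) *\<^sub>R z :: vec3"
    let ?R = "\<lambda>j m z. k / c ^ 3 * ray_average (gauss_hessian j m) (?\<eta> z)"
    let ?h = "\<lambda>j m z. if j = (m :: 3) then heat_kernel \<nu> z t else 0"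
    have "\<bar>NS_kernel \<nu> z t $ j $ m\<bar> \<le> (D + k * H) * (c + norm z) powr (-3)" for j m
    proof -
      have "\<bar>ray_average (gauss_hessian j m) (?\<eta> z)\<bar> \<le> H / (1 + norm (?\<eta> z)) ^ 3"
        by (rule order.trans[OF ray_average_decay(1)[OF A] divide_right_mono[OF AH]]) simp
      then have "k / c ^ 3 * \<bar>ray_average (gauss_hessian j m) (?\<eta> z)\<bar> \<le> k / c ^ 3 * (H / (1 + norm (?\<eta> z)) ^ 3)"
        using k c by (intro mult_left_mono) auto
      also have "\<dots> = k * H * (1 / c ^ 3 / (1 + norm (?\<eta> z)) ^ 3)" by simp
      also have "\<dots> = k * H * (c + norm z) powr (-3)" using scaled_weight[OF c, of 3 z] by simp
      finally have 1: "\<bar>?R j m z\<bar> \<le> k * H * (c + norm z) powr (-3)"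
        using k c by (simp add: abs_mult)
      have "D * c * (c + norm z) powr (-4) \<le> D * (c + norm z) powr 1 * (c + norm z) powr (-4)"
        using D c by (intro mult_right_mono mult_left_mono) auto
      also have "\<dots> = D * (c + norm z) powr (-3)" by (simp only: mult.assoc flip: powr_add) simp
      finally have 2: "\<bar>?h j m z\<bar> \<le> D * (c + norm z) powr (-3)"
        using heat[OF \<open>\<nu> > 0\<close> \<open>t > 0\<close>, of z] D by (auto simp flip: c_def)
      show ?thesis
        unfolding scaling distrib_right by (rule order.trans[OF abs_triangle_ineq add_mono[OF 2 1]])
    qed
    from norm_matrix_vector_le_entries[OF this, of w]
    show "norm (NS_kernel \<nu> z t *v w) \<le> 9 * (D + k * H) * (diffusion_length \<nu> t + norm z) powr (-3) * norm w"
      by (simp only: c_def mult.assoc)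
    fix z' :: vec3
    assume near: "norm (z' - z) \<le> (diffusion_length \<nu> t + norm z) / 2"
    note near' = scaled_near[OF c near[folded c_def]]
    have "\<bar>(NS_kernel \<nu> z' t - NS_kernel \<nu> z t) $ j $ m\<bar>
        \<le> (D + k * H) * (norm (z' - z) * (c + norm z) powr (-4))" for j m
    proof -
      have "\<bar>ray_average (gauss_hessian j m) (?\<eta> z') - ray_average (gauss_hessian j m) (?\<eta> z)\<bar>
          \<le> A j m * (norm (z' - z) / c) / (1 + norm (?\<eta> z)) ^ 4"
        using ray_average_decay(2)[OF A near'(2), of j m] unfolding near'(1) .
      also have "\<dots> \<le> H * (norm (z' - z) / c) / (1 + norm (?\<eta> z)) ^ 4"
        using AH c by (intro divide_right_mono mult_right_mono) auto
      finally have "k / c ^ 3 * \<bar>ray_average (gauss_hessian j m) (?\<eta> z') - ray_average (gauss_hessian j m) (?\<eta> z)\<bar>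
          \<le> k / c ^ 3 * (H * (norm (z' - z) / c) / (1 + norm (?\<eta> z)) ^ 4)"
        using k c by (intro mult_left_mono) auto
      also have "\<dots> = k * H * norm (z' - z) * (1 / c ^ 4 / (1 + norm (?\<eta> z)) ^ 4)"
        by (simp add: eval_nat_numeral mult_ac)
      also have "\<dots> = k * H * norm (z' - z) * (c + norm z) powr (-4)"
        using scaled_weight[OF c, of 4 z] by simp
      finally have "\<bar>k / c ^ 3 * (ray_average (gauss_hessian j m) (?\<eta> z') - ray_average (gauss_hessian j m) (?\<eta> z))\<bar>
          \<le> k * H * norm (z' - z) * (c + norm z) powr (-4)"
        using k c by (simp add: abs_mult)
      then have 1: "\<bar>?R j m z' - ?R j m z\<bar> \<le> k * H * norm (z' - z) * (c + norm z) powr (-4)"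
        unfolding right_diff_distrib .
      have 2: "\<bar>?h j m z' - ?h j m z\<bar> \<le> D * norm (z' - z) * (c + norm z) powr (-4)"
        using heat'[OF \<open>\<nu> > 0\<close> \<open>t > 0\<close> near] D by (auto simp flip: c_def)
      have "\<bar>a' + b' - (a + b)\<bar> \<le> p + q"
        if "\<bar>a' - a\<bar> \<le> p" "\<bar>b' - b\<bar> \<le> q" for a a' b b' p q :: real
        using that by linarith
      from this[OF 2 1]
      have "\<bar>?h j m z' + ?R j m z' - (?h j m z + ?R j m z)\<bar>
          \<le> (D + k * H) * (norm (z' - z) * (c + norm z) powr (-4))"
        by (simp add: distrib_right mult.assoc)
      then show ?thesis unfolding vector_minus_component scaling .
    qed
    from norm_matrix_vector_le_entries[OF this, of w]
    show "norm (NS_kernel \<nu> z' t *v w - NS_kernel \<nu> z t *v w)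
        \<le> 9 * (D + k * H) * norm (z' - z) * (diffusion_length \<nu> t + norm z) powr (-4) * norm w"
      by (simp only: c_def mult.assoc matrix_vector_mult_diff_rdistrib)
  qed
qed

text \<open>
  A bound for differences with no restriction on the increment, at the price of a factor \<open>1/c\<close> and of a
  second weight centred at the other point. For small increments \<open>(c + |z|)^(-4) \<le> c^(-1) (c + |z|)^(-3)\<close>; an
  increment larger than \<open>c/2\<close> itself pays for the factor \<open>1/c\<close>. Uniformity in the increment is essential
  because \<open>c\<close> becomes arbitrarily small in the time integral while the increment is fixed.
\<close>

lemma difference_bound:
  fixes \<phi> :: "vec3 \<Rightarrow> 'a :: real_normed_vector"
  assumes c: "c > 0" and C: "C \<ge> 0"
    and size: "\<And>z. norm (\<phi> z) \<le> C * (c + norm z) powr (-3)"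
    and lip: "\<And>z z'. norm (z' - z) \<le> (c + norm z) / 2 \<Longrightarrow>
      norm (\<phi> z' - \<phi> z) \<le> C * norm (z' - z) * (c + norm z) powr (-4)"
  shows "norm (\<phi> z' - \<phi> z)
    \<le> 2 * C * norm (z' - z) / c * ((c + norm z) powr (-3) + (c + norm z') powr (-3))"
proof (cases "norm (z' - z) \<le> (c + norm z) / 2")
  case True
  have "(c + norm z) powr (-4) = (c + norm z) powr (-1) * (c + norm z) powr (-3)"
    by (simp only: flip: powr_add) simp
  also have "\<dots> \<le> c powr (-1) * (c + norm z) powr (-3)"
    using c by (intro mult_right_mono powr_mono2') auto
  also have "c powr (-1) = 1 / c" using c by (simp add: powr_minus_divide)
  finally have 1: "(c + norm z) powr (-4) \<le> 1 / c * (c + norm z) powr (-3)" .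
  have "norm (\<phi> z' - \<phi> z) \<le> C * norm (z' - z) * (1 / c * (c + norm z) powr (-3))"
    using C by (intro order.trans[OF lip[OF True]] mult_left_mono 1) auto
  also have "\<dots> = 1 * (C * norm (z' - z) / c * (c + norm z) powr (-3))" by simp
  also have "\<dots> \<le> 2 * (C * norm (z' - z) / c * ((c + norm z) powr (-3) + (c + norm z') powr (-3)))"
    using C c by (intro mult_mono mult_left_mono) auto
  finally show ?thesis by simp
next
  case False
  then have "c + norm z < 2 * norm (z' - z)" by (simp add: field_simps)
  then have "c \<le> 2 * norm (z' - z)" using norm_ge_zero[of z] by linarith
  then have "1 \<le> 2 * norm (z' - z) / c" using c by simp
  have "norm (\<phi> z' - \<phi> z) \<le> norm (\<phi> z') + norm (\<phi> z)" by (rule norm_triangle_ineq4)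
  also have "\<dots> \<le> 1 * (C * ((c + norm z) powr (-3) + (c + norm z') powr (-3)))"
    using size[of z] size[of z'] by (simp add: distrib_left)
  also have "\<dots> \<le> 2 * norm (z' - z) / c * (C * ((c + norm z) powr (-3) + (c + norm z') powr (-3)))"
    using \<open>1 \<le> _\<close> C by (intro mult_right_mono) auto
  finally show ?thesis by (simp add: mult_ac)
qed

section \<open>An abstract bound for space-time integrals\<close>

lemma jointly_measurable_swap:
  assumes "jointly_measurable f"
  shows "(\<lambda>(s, y). indicator {0..} s *\<^sub>R f y s) \<in> borel_measurable (lborel \<Otimes>\<^sub>M lborel)"
proof -
  let ?S = "UNIV \<times> {0..} :: (vec3 \<times> real) set"
  have "closed ?S" by (intro closed_Times) auto
  then have "?S \<inter> space borel \<in> sets borel" by simp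
  then have "(\<lambda>p. indicator ?S p *\<^sub>R (case p of (x, t) \<Rightarrow> f x t)) \<in> borel_measurable borel"
    using assms borel_measurable_restrict_space_iff unfolding jointly_measurable_def by blast
  then have m: "(\<lambda>p. indicator ?S p *\<^sub>R (case p of (x, t) \<Rightarrow> f x t)) \<in> borel_measurable (borel \<Otimes>\<^sub>M borel)"
    by (simp add: borel_prod)
  have "(\<lambda>q. (snd q, fst q)) \<in> (borel \<Otimes>\<^sub>M borel) \<rightarrow>\<^sub>M (borel \<Otimes>\<^sub>M borel :: (vec3 \<times> real) measure)"
    by measurable
  from measurable_compose[OF this m]
  have "(\<lambda>(s, y). indicator {0..} s *\<^sub>R f y s) \<in> borel_measurable (borel \<Otimes>\<^sub>M borel)"
    by (simp add: case_prod_beta indicator_def)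
  then show ?thesis
    by (subst measurable_cong_sets[OF sets_pair_measure_cong refl]) auto
qed

text \<open>
  Near the origin nothing bounds \<open>f\<close> uniformly in time; this is the only control there, and
  it is integrable in time by the assumption on the \<open>L\<^sup>2\<close> norms.
\<close>

definition local_mass :: "real \<Rightarrow> tvfield \<Rightarrow> real \<Rightarrow> ennreal" where
  "local_mass R f s = (\<integral>\<^sup>+ y\<in>cball 0 R. ennreal (norm (f y s)) \<partial>lborel)"

lemma local_mass_measurable:
  assumes "jointly_measurable f"
  shows "(\<lambda>s. local_mass R f s * indicator {0..t} s) \<in> borel_measurable lborel"
proof -
  have [measurable]: "(cball 0 R :: vec3 set) \<in> sets borel" by simp
  define g where "g = (\<lambda>(s, y). indicator {0..} s *\<^sub>R f y s)"
  have [measurable]: "g \<in> borel_measurable (lborel \<Otimes>\<^sub>M lborel)"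
    unfolding g_def by (rule jointly_measurable_swap[OF assms])
  have "(\<lambda>s. \<integral>\<^sup>+ y. ennreal (norm (g (s, y))) * indicator (cball 0 R) y \<partial>lborel) \<in> borel_measurable lborel"
    by measurable
  then have "(\<lambda>s. \<integral>\<^sup>+ y\<in>cball 0 R. ennreal (norm (indicator {0..} s *\<^sub>R f y s)) \<partial>lborel) \<in> borel_measurable lborel"
    by (simp add: g_def)
  then have "(\<lambda>s. (\<integral>\<^sup>+ y\<in>cball 0 R. ennreal (norm (indicator {0..} s *\<^sub>R f y s)) \<partial>lborel)
      * indicator {0..t} s) \<in> borel_measurable lborel"
    by measurable
  also have "(\<lambda>s. (\<integral>\<^sup>+ y\<in>cball 0 R. ennreal (norm (indicator {0..} s *\<^sub>R f y s)) \<partial>lborel)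
      * indicator {0..t} s) = (\<lambda>s. local_mass R f s * indicator {0..t} s)"
    by (rule ext) (simp add: local_mass_def indicator_def)
  finally show ?thesis .
qed

lemma local_mass_le_L2_norm:
  assumes "(\<lambda>y. f y s) \<in> borel_measurable borel"
  shows "local_mass R f s \<le> ennreal (1 + measure lborel (cball 0 R :: vec3 set)) * L2_norm_at f s"
proof (cases "(\<integral>\<^sup>+ x. ennreal ((norm (f x s))\<^sup>2) \<partial>lborel) = \<infinity>")
  case True
  then have "L2_norm_at f s = \<infinity>" by (simp add: L2_norm_at_def ennreal_sqrt_def)
  moreover have "0 < 1 + measure lborel (cball 0 R :: vec3 set)" by (simp add: add_pos_nonneg)
  ultimately show ?thesis by (simp add: ennreal_mult_top)
next
  case False
  then obtain e where e: "(\<integral>\<^sup>+ x. ennreal ((norm (f x s))\<^sup>2) \<partial>lborel) = ennreal e" "e \<ge> 0"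
    by (cases "\<integral>\<^sup>+ x. ennreal ((norm (f x s))\<^sup>2) \<partial>lborel") auto
  define V where "V = measure lborel (cball 0 R :: vec3 set)"
  have V: "emeasure lborel (cball 0 R :: vec3 set) = ennreal V"
    using emeasure_lborel_cball_finite[of "0 :: vec3" R] by (simp add: V_def emeasure_eq_ennreal_measure)
  have "(local_mass R f s)\<^sup>2 = (\<integral>\<^sup>+ y. indicator (cball 0 R) y * ennreal (norm (f y s)) \<partial>lborel)\<^sup>2"
    by (simp add: local_mass_def mult.commute)
  also have "\<dots> \<le> (\<integral>\<^sup>+ y. (indicator (cball 0 R :: vec3 set) y)\<^sup>2 \<partial>lborel) * (\<integral>\<^sup>+ y. (ennreal (norm (f y s)))\<^sup>2 \<partial>lborel)"
    using assms borel_closed[of "cball 0 R :: vec3 set"]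
    by (intro Cauchy_Schwarz_nn_integral) (auto intro!: borel_measurable_indicator)
  also have "(\<lambda>y. (indicator (cball 0 R) y)\<^sup>2 :: ennreal) = (indicator (cball 0 R :: vec3 set))"
    by (auto simp: indicator_def)
  also have "(\<integral>\<^sup>+ y. indicator (cball 0 R :: vec3 set) y \<partial>lborel) * (\<integral>\<^sup>+ y. (ennreal (norm (f y s)))\<^sup>2 \<partial>lborel) = ennreal (V * e)"
    using e V by (simp add: V_def ennreal_power ennreal_mult)
  finally have sq: "(local_mass R f s)\<^sup>2 \<le> ennreal (V * e)" .
  then obtain l where l: "local_mass R f s = ennreal l" "l \<ge> 0"
    by (cases "local_mass R f s") (auto simp: power2_eq_square ennreal_top_mult top_unique)
  have "l\<^sup>2 \<le> V * e" using sq e l by (simp add: ennreal_power V_def)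
  then have "l \<le> sqrt V * sqrt e" using real_le_rsqrt by (simp flip: real_sqrt_mult)
  also have "\<dots> \<le> (1 + V) * sqrt e"
  proof (rule mult_right_mono)
    have "V \<le> (1 + V)\<^sup>2" by (simp add: V_def power2_eq_square algebra_simps)
    then show "sqrt V \<le> 1 + V" by (intro real_le_lsqrt) (simp_all add: V_def)
  qed (use e in simp)
  finally show ?thesis
    using e l ennreal_leI by (simp add: L2_norm_at_def ennreal_sqrt_def V_def flip: ennreal_mult del: ennreal_plus)
qed

text \<open>
  The forcing consists of a part of size \<open>|y|^(-2)\<close>, uniform in time, and a part on the ball of radius \<open>R\<close>
  that is merely integrable in space-time. The first is paired with a kernel bound \<open>k\<close> whose space
  integral may blow up like \<open>(t - s)^(-\<kappa>)\<close>; the second needs a kernel bound \<open>M\<close> without any singularity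
  in time, which is available because it is only used for \<open>x\<close> far from that ball. The integrand is
  described by \<open>J\<close>, dominated by the absolute integral of \<open>I\<close> for almost every time, so that differences of
  two convergent integrals are covered.
\<close>

lemma duhamel_bound:
  fixes I :: "real \<Rightarrow> vec3 \<Rightarrow> vec3" and J :: "real \<Rightarrow> vec3" and k :: "real \<Rightarrow> vec3 \<Rightarrow> real"
  assumes t: "t \<ge> 0" and \<kappa>: "\<kappa> < 1" and pos: "A \<ge> 0" "B \<ge> 0" "M \<ge> 0"
    and f: "jointly_measurable f" "\<And>s. s \<ge> 0 \<Longrightarrow> (\<lambda>y. f y s) \<in> borel_measurable borel"
    and J: "AE s in lborel. s \<in> {0..t} \<longrightarrow> ennreal (norm (J s)) \<le> (\<integral>\<^sup>+ y. ennreal (norm (I s y)) \<partial>lborel)"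
      "set_integrable lborel {0..t} J"
    and F: "\<And>s y. 0 \<le> s \<Longrightarrow> s < t \<Longrightarrow>
      norm (F y s) \<le> A * (1 + norm y) powr (-2) + indicator (cball 0 R) y * norm (f y s)"
    and k: "\<And>s y. 0 \<le> s \<Longrightarrow> s < t \<Longrightarrow> 0 \<le> k s y"
      "\<And>s. 0 \<le> s \<Longrightarrow> s < t \<Longrightarrow> k s \<in> borel_measurable borel"
      "\<And>s. 0 \<le> s \<Longrightarrow> s < t \<Longrightarrow>
        (\<integral>\<^sup>+ y. ennreal (k s y * (1 + norm y) powr (-2)) \<partial>lborel) \<le> ennreal (B * (t - s) powr (-\<kappa>))"
    and I: "\<And>s y. 0 \<le> s \<Longrightarrow> s < t \<Longrightarrow> norm (I s y) \<le> k s y * norm (F y s)"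
      "\<And>s y. 0 \<le> s \<Longrightarrow> s < t \<Longrightarrow> norm y \<le> R \<Longrightarrow> norm (I s y) \<le> M * norm (F y s)"
  shows "ennreal (norm (LBINT s:{0..t}. J s))
    \<le> ennreal (A * B * (t powr (1 - \<kappa>) / (1 - \<kappa>)))
      + ennreal M * (\<integral>\<^sup>+ s\<in>{0..t}. local_mass R f s \<partial>lborel)"
proof -
  have slice: "(\<integral>\<^sup>+ y. ennreal (norm (I s y)) \<partial>lborel)
      \<le> ennreal (A * B * (t - s) powr (-\<kappa>)) + ennreal M * local_mass R f s"
    if s: "0 \<le> s" "s < t" for s
  proof -
    have pw: "norm (I s y) \<le> A * (k s y * (1 + norm y) powr (-2)) + M * (norm (f y s) * indicator (cball 0 R) y)" for y
    proof (cases "norm y \<le> R")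
      case False
      have "norm (I s y) \<le> k s y * (A * (1 + norm y) powr (-2))"
        using F[OF s, of y] False by (intro order.trans[OF I(1)[OF s]] mult_left_mono k s) simp
      then show ?thesis using False by (simp add: mult_ac)
    next
      case True
      let ?a = "A * (1 + norm y) powr (-2)"
      have "norm (I s y) \<le> min (k s y) M * norm (F y s)"
        using I(1)[OF s, of y] I(2)[OF s True] by (simp add: min_def)
      also have "\<dots> \<le> min (k s y) M * (?a + norm (f y s))"
        using F[OF s, of y] True k(1)[OF s] pos by (intro mult_left_mono) auto
      also have "\<dots> = min (k s y) M * ?a + min (k s y) M * norm (f y s)" by (rule distrib_left)
      also have "\<dots> \<le> k s y * ?a + M * norm (f y s)"
        using pos by (intro add_mono mult_right_mono) auto
      finally show ?thesis using True by (simp add: mult_ac)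
    qed
    note [measurable] = k(2)[OF s] f(2)[OF s(1)]
    have [measurable]: "(cball 0 R :: vec3 set) \<in> sets borel" by simp
    have "(\<integral>\<^sup>+ y. ennreal (norm (I s y)) \<partial>lborel)
        \<le> (\<integral>\<^sup>+ y. ennreal A * ennreal (k s y * (1 + norm y) powr (-2))
             + ennreal M * (ennreal (norm (f y s)) * indicator (cball 0 R) y) \<partial>lborel)"
    proof (rule nn_integral_mono)
      fix y
      have "ennreal (norm (I s y))
          \<le> ennreal (A * (k s y * (1 + norm y) powr (-2)) + M * (norm (f y s) * indicator (cball 0 R) y))"
        by (rule ennreal_leI[OF pw])
      also have "\<dots> = ennreal A * ennreal (k s y * (1 + norm y) powr (-2))
             + ennreal M * (ennreal (norm (f y s)) * indicator (cball 0 R) y)"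
        using pos k(1)[OF s, of y] by (simp add: ennreal_mult indicator_def)
      finally show "ennreal (norm (I s y)) \<le> ennreal A * ennreal (k s y * (1 + norm y) powr (-2))
             + ennreal M * (ennreal (norm (f y s)) * indicator (cball 0 R) y)" .
    qed
    also have "\<dots> = ennreal A * (\<integral>\<^sup>+ y. ennreal (k s y * (1 + norm y) powr (-2)) \<partial>lborel)
        + ennreal M * local_mass R f s"
      unfolding local_mass_def by (subst nn_integral_add) (auto simp: nn_integral_cmult)
    also have "\<dots> \<le> ennreal A * ennreal (B * (t - s) powr (-\<kappa>)) + ennreal M * local_mass R f s"
      by (intro add_right_mono mult_left_mono k s) auto
    also have "ennreal A * ennreal (B * (t - s) powr (-\<kappa>)) = ennreal (A * B * (t - s) powr (-\<kappa>))"
      using pos by (simp add: mult.assoc ennreal_mult)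
    finally show ?thesis .
  qed
  have "ennreal (norm (LBINT s:{0..t}. J s))
      \<le> (\<integral>\<^sup>+ s. ennreal (norm (indicator {0..t} s *\<^sub>R J s)) \<partial>lborel)"
    using J(2) unfolding set_lebesgue_integral_def set_integrable_def by (rule integral_norm_bound_ennreal)
  also have "\<dots> \<le> (\<integral>\<^sup>+ s. ennreal (A * B) * (ennreal ((t - s) powr (-\<kappa>)) * indicator {0..t} s)
      + ennreal M * (local_mass R f s * indicator {0..t} s) \<partial>lborel)"
  proof (rule nn_integral_mono_AE)
    show "AE s in lborel. ennreal (norm (indicator {0..t} s *\<^sub>R J s))
        \<le> ennreal (A * B) * (ennreal ((t - s) powr (-\<kappa>)) * indicator {0..t} s)
          + ennreal M * (local_mass R f s * indicator {0..t} s)"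
      using J(1) AE_lborel_singleton[of t]
    proof eventually_elim
      case (elim s)
      show ?case
      proof (cases "s \<in> {0..t}")
        case True
        then have s: "0 \<le> s" "s < t" using elim by auto
        have "ennreal (norm (J s)) \<le> (\<integral>\<^sup>+ y. ennreal (norm (I s y)) \<partial>lborel)"
          using elim True by simp
        also note slice[OF s]
        finally show ?thesis using True pos by (simp add: ennreal_mult)
      qed simp
    qed
  qed
  also have "\<dots> = ennreal (A * B) * (\<integral>\<^sup>+ s\<in>{0..t}. ennreal ((t - s) powr (-\<kappa>)) \<partial>lborel)
      + ennreal M * (\<integral>\<^sup>+ s\<in>{0..t}. local_mass R f s \<partial>lborel)"
    using local_mass_measurable[OF f(1), of R t]
    by (subst nn_integral_add) (auto simp: nn_integral_cmult)
  also have "ennreal (A * B) * (\<integral>\<^sup>+ s\<in>{0..t}. ennreal ((t - s) powr (-\<kappa>)) \<partial>lborel)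
      = ennreal (A * B * (t powr (1 - \<kappa>) / (1 - \<kappa>)))"
    unfolding nn_integral_powr_singularity_reflected[OF t \<kappa>]
    using pos \<kappa> by (intro ennreal_mult[symmetric]) auto
  finally show ?thesis .
qed

section \<open>Decay of the Duhamel term\<close>

text \<open>
  On a bounded time interval all the singularities in the kernel estimates are dominated by the worst one,
  \<open>\<tau>^(-5/8)\<close>, which comes from the gradient: \<open>\<tau>^(-1/2)\<close> from the differentiation and \<open>\<tau>^(-1/8)\<close>
  from \<open>convolution_decay\<close>.
\<close>

lemma diffusion_length_powr_le:
  assumes "\<nu> > 0" "T > 0"
  obtains L where "L \<ge> 0"
    "\<And>\<tau> q. 0 < \<tau> \<Longrightarrow> \<tau> \<le> T \<Longrightarrow> 0 \<le> q \<Longrightarrow> q \<le> 5/4 \<Longrightarrow>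
       diffusion_length \<nu> \<tau> powr (-q) \<le> L * \<tau> powr (-5/8)"
proof -
  define M where "M = 1 + diffusion_length \<nu> T"
  define L where "L = (4 * \<nu>) powr (-5/8) * M powr (5/4)"
  have M: "M \<ge> 1" using assms diffusion_length_pos[of \<nu> T] by (simp add: M_def)
  show thesis
  proof (rule that[of L])
    show "L \<ge> 0" by (simp add: L_def)
    fix \<tau> q :: real
    assume \<tau>: "0 < \<tau>" "\<tau> \<le> T" and q: "0 \<le> q" "q \<le> 5/4"
    let ?c = "diffusion_length \<nu> \<tau>"
    have c: "?c > 0" using assms \<tau> by (simp add: diffusion_length_pos)
    have "?c \<le> diffusion_length \<nu> T" using assms \<tau> by (simp add: diffusion_length_def)
    then have cM: "?c \<le> M" by (simp add: M_def)
    have "?c powr (5/4 - q) \<le> M powr (5/4 - q)"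
      using c cM q by (intro powr_mono2) auto
    also have "\<dots> \<le> M powr (5/4)" using M q by (intro powr_mono) auto
    finally have 1: "?c powr (5/4 - q) \<le> M powr (5/4)" .
    have "?c powr (-5/4) = ((4 * \<nu> * \<tau>) powr (1/2)) powr (-5/4)"
      using assms \<tau> by (simp add: diffusion_length_def powr_half_sqrt)
    also have "\<dots> = (4 * \<nu> * \<tau>) powr (-5/8)" by (simp add: powr_powr)
    also have "\<dots> = (4 * \<nu>) powr (-5/8) * \<tau> powr (-5/8)"
      using assms \<tau> by (simp add: powr_mult)
    finally have 2: "?c powr (-5/4) = (4 * \<nu>) powr (-5/8) * \<tau> powr (-5/8)" .
    have "?c powr (-q) = ?c powr (-5/4) * ?c powr (5/4 - q)" by (simp flip: powr_add)
    also have "\<dots> \<le> ?c powr (-5/4) * M powr (5/4)" by (intro mult_left_mono 1) simp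
    also have "\<dots> = L * \<tau> powr (-5/8)" unfolding 2 L_def by simp
    finally show "?c powr (-q) \<le> L * \<tau> powr (-5/8)" .
  qed
qed

lemma norm_column_le: "norm (column j M) \<le> norm (M :: real ^ 3 ^ 3)"
  unfolding norm_vec_def[of M] norm_vec_def[of "column j M"]
  by (intro L2_set_mono) (auto simp: column_def component_le_norm_cart)

lemma norm_convect_le: "norm (convect u x t) \<le> 3 * norm (u x t) * norm (grad u x t)"
proof -
  have "norm (convect u x t) \<le> (\<Sum>j\<in>UNIV. norm ((u x t $ j) *\<^sub>R column j (grad u x t)))"
    unfolding convect_def by (rule norm_sum)
  also have "\<dots> \<le> (\<Sum>j\<in>(UNIV :: 3 set). norm (u x t) * norm (grad u x t))"
    unfolding norm_scaleR
    by (intro sum_mono mult_mono norm_column_le component_le_norm_cart) auto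
  finally show ?thesis by simp
qed

lemma weight_shift:
  fixes x x' :: vec3
  assumes "norm (x' - x) \<le> 1/2"
  shows "(1 + norm x') powr (-7/4) \<le> 4 * (1 + norm x) powr (-7/4)"
proof -
  have "norm x \<le> norm x' + 1/2" using norm_triangle_sub[of x x'] assms by (simp add: norm_minus_commute)
  then have "1 + norm x \<le> 2 + 2 * norm x'" using norm_ge_zero[of x'] by linarith
  then have "(1 + norm x) / 2 \<le> 1 + norm x'" by simp
  then have "(1 + norm x') powr (-7/4) \<le> ((1 + norm x) / 2) powr (-7/4)"
    by (intro powr_mono2') (auto simp: add_pos_nonneg)
  also have "\<dots> = 2 powr (7/4) * (1 + norm x) powr (-7/4)"
    by (simp add: powr_divide powr_minus field_simps)
  also have "\<dots> \<le> 2 powr 2 * (1 + norm x) powr (-7/4)"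
    by (intro mult_right_mono powr_mono) auto
  finally show ?thesis by simp
qed

lemma far_weight:
  fixes x y :: vec3
  assumes "norm y \<le> R" "1 + 4 * R \<le> norm x" "c \<ge> 0" "p \<ge> 7/4"
  shows "(c + norm (x - y)) powr (-p) \<le> 4 powr p * (1 + norm x) powr (-7/4)"
proof -
  have "1 + norm x \<le> 4 * c + 4 * norm (x - y)"
    using norm_triangle_ineq2[of x y] assms(1-3) norm_ge_zero[of x] by linarith
  then have "(1 + norm x) / 4 \<le> c + norm (x - y)" by simp
  then have "(c + norm (x - y)) powr (-p) \<le> ((1 + norm x) / 4) powr (-p)"
    using assms by (intro powr_mono2') (auto simp: add_pos_nonneg)
  also have "\<dots> = 4 powr p * (1 + norm x) powr (-p)"
    by (simp add: powr_divide powr_minus field_simps)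
  also have "\<dots> \<le> 4 powr p * (1 + norm x) powr (-7/4)"
    using assms by (intro mult_left_mono powr_mono) auto
  finally show ?thesis .
qed

definition duhamel_term :: "real \<Rightarrow> tvfield \<Rightarrow> vec3 \<Rightarrow> real \<Rightarrow> vec3" where
  "duhamel_term \<nu> F x t = (LBINT s:{0..t}. \<integral>y. NS_kernel \<nu> (x - y) (t - s) *v F y s \<partial>lborel)"

definition duhamel_converges :: "real \<Rightarrow> tvfield \<Rightarrow> vec3 \<Rightarrow> real \<Rightarrow> bool" where
  "duhamel_converges \<nu> F x t \<longleftrightarrow>
     (AE s in lborel. s \<in> {0..t} \<longrightarrow> integrable lborel (\<lambda>y. NS_kernel \<nu> (x - y) (t - s) *v F y s)) \<and>
     set_integrable lborel {0..t} (\<lambda>s. \<integral>y. NS_kernel \<nu> (x - y) (t - s) *v F y s \<partial>lborel)"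

text \<open>
  Shape of the total forcing \<open>F\<close> for a solution: the quadratic term has decay \<open>|y|^(-2)\<close>, as has \<open>f\<close> away
  from the ball of radius \<open>R\<close>.
\<close>

definition forcing_bound :: "real \<Rightarrow> real \<Rightarrow> real \<Rightarrow> tvfield \<Rightarrow> tvfield \<Rightarrow> bool" where
  "forcing_bound T A R f F \<longleftrightarrow>
     A \<ge> 0 \<and> jointly_measurable f \<and>
     (\<forall>s\<ge>0. (\<lambda>y. f y s) \<in> borel_measurable borel) \<and>
     (\<integral>\<^sup>+ s\<in>{0..T}. local_mass R f s \<partial>lborel) < \<infinity> \<and>
     (\<forall>s\<in>{0..T}. \<forall>y. norm (F y s) \<le> A * (1 + norm y) powr (-2) + indicator (cball 0 R) y * norm (f y s))"

text \<open>
  The source decays like \<open>|y|^(-2)\<close> and the kernel like \<open>|z|^(-3)\<close>, so the potential inherits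
  \<open>|x|^(-2)\<close> up to a logarithm; \<open>|x|^(-7/4)\<close> absorbs the logarithm. The difference estimate has the same
  spatial rate, since one power of the kernel decay is traded for the factor \<open>1/c\<close>.
\<close>

lemma duhamel_decay:
  assumes "\<nu> > 0" "T > 0" "forcing_bound T A R f F"
  obtains C where "C \<ge> 0"
    "\<And>t x. 0 \<le> t \<Longrightarrow> t \<le> T \<Longrightarrow> 1 + 4 * R \<le> norm x \<Longrightarrow> duhamel_converges \<nu> F x t \<Longrightarrow>
       norm (duhamel_term \<nu> F x t) \<le> C * (1 + norm x) powr (-7/4)"
    "\<And>t x x'. 0 \<le> t \<Longrightarrow> t \<le> T \<Longrightarrow> 1 + 4 * R \<le> norm x \<Longrightarrow> norm (x' - x) \<le> 1/4 \<Longrightarrow>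
       duhamel_converges \<nu> F x t \<Longrightarrow> duhamel_converges \<nu> F x' t \<Longrightarrow>
       norm (duhamel_term \<nu> F x' t - duhamel_term \<nu> F x t) \<le> C * norm (x' - x) * (1 + norm x) powr (-7/4)"
proof -
  obtain C where C: "C \<ge> 0"
    and G: "\<And>t z w. t > 0 \<Longrightarrow> norm (NS_kernel \<nu> z t *v w)
       \<le> C * (diffusion_length \<nu> t + norm z) powr (-3) * norm w"
    and G': "\<And>t z z' w. t > 0 \<Longrightarrow> norm (z' - z) \<le> (diffusion_length \<nu> t + norm z) / 2 \<Longrightarrow>
       norm (NS_kernel \<nu> z' t *v w - NS_kernel \<nu> z t *v w)
       \<le> C * norm (z' - z) * (diffusion_length \<nu> t + norm z) powr (-4) * norm w"
    using NS_kernel_bounds \<open>\<nu> > 0\<close> by metis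
  obtain K where K: "K \<ge> 0" "\<And>c x. c > 0 \<Longrightarrow>
       (\<integral>\<^sup>+ y. ennreal ((c + norm (x - y :: vec3)) powr (-3) * (1 + norm y) powr (-2)) \<partial>lborel)
       \<le> ennreal (K * (c powr (-1/4) + 1) * (1 + norm x) powr (-7/4))"
    using convolution_decay by blast
  obtain L where L: "L \<ge> 0" "\<And>\<tau> q. 0 < \<tau> \<Longrightarrow> \<tau> \<le> T \<Longrightarrow> 0 \<le> q \<Longrightarrow> q \<le> 5/4 \<Longrightarrow>
       diffusion_length \<nu> \<tau> powr (-q) \<le> L * \<tau> powr (-5/8)"
    using diffusion_length_powr_le[OF assms(1,2)] by blast
  have A: "A \<ge> 0" and f: "jointly_measurable f" "\<And>s. s \<ge> 0 \<Longrightarrow> (\<lambda>y. f y s) \<in> borel_measurable borel"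
    and F: "\<And>s y. 0 \<le> s \<Longrightarrow> s \<le> T \<Longrightarrow>
      norm (F y s) \<le> A * (1 + norm y) powr (-2) + indicator (cball 0 R) y * norm (f y s)"
    using assms(3) by (auto simp: forcing_bound_def)
  obtain \<Phi> where \<Phi>: "\<Phi> \<ge> 0" "(\<integral>\<^sup>+ s\<in>{0..T}. local_mass R f s \<partial>lborel) = ennreal \<Phi>"
    using assms(3) unfolding forcing_bound_def
    by (cases "\<integral>\<^sup>+ s\<in>{0..T}. local_mass R f s \<partial>lborel") auto
  define \<Theta> where "\<Theta> = T powr (3/8) / (3/8)"
  have \<Theta>: "\<Theta> \<ge> 0" by (simp add: \<Theta>_def)
  \<comment> \<open>\<open>\<kappa> = 5/8\<close> is the singularity of the gradient; the values are less singular but use it as well\<close>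
  have core: "norm (LBINT s:{0..t}. J s) \<le> A * B * \<Theta> + M * \<Phi>"
    if t: "0 \<le> t" "t \<le> T" and pos: "B \<ge> 0" "M \<ge> 0"
    and J: "AE s in lborel. s \<in> {0..t} \<longrightarrow> ennreal (norm (J s)) \<le> (\<integral>\<^sup>+ y. ennreal (norm (I s y)) \<partial>lborel)"
      "set_integrable lborel {0..t} J"
    and k: "\<And>s y. 0 \<le> s \<Longrightarrow> s < t \<Longrightarrow> 0 \<le> k s y"
      "\<And>s. 0 \<le> s \<Longrightarrow> s < t \<Longrightarrow> k s \<in> borel_measurable borel"
      "\<And>s. 0 \<le> s \<Longrightarrow> s < t \<Longrightarrow>
        (\<integral>\<^sup>+ y. ennreal (k s y * (1 + norm y) powr (-2)) \<partial>lborel) \<le> ennreal (B * (t - s) powr (-5/8))"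
    and I: "\<And>s y. 0 \<le> s \<Longrightarrow> s < t \<Longrightarrow> norm (I s y) \<le> k s y * norm (F y s)"
      "\<And>s y. 0 \<le> s \<Longrightarrow> s < t \<Longrightarrow> norm y \<le> R \<Longrightarrow> norm (I s y) \<le> M * norm (F y s)"
    for t B M and J :: "real \<Rightarrow> vec3" and I :: "real \<Rightarrow> vec3 \<Rightarrow> vec3" and k
  proof -
    have "ennreal (norm (LBINT s:{0..t}. J s))
        \<le> ennreal (A * B * (t powr (1 - 5/8) / (1 - 5/8)))
          + ennreal M * (\<integral>\<^sup>+ s\<in>{0..t}. local_mass R f s \<partial>lborel)"
      by (rule duhamel_bound[where I = I and k = k and F = F]) (use assms t pos A f J k I F in auto)
    also have "\<dots> \<le> ennreal (A * B * \<Theta>) + ennreal M * (\<integral>\<^sup>+ s\<in>{0..T}. local_mass R f s \<partial>lborel)"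
      unfolding \<Theta>_def using t A pos
      by (intro add_mono mult_left_mono ennreal_leI divide_right_mono powr_mono2 nn_integral_mono)
         (auto simp: indicator_def powr_mono2)
    also have "\<dots> = ennreal (A * B * \<Theta> + M * \<Phi>)"
      using A pos \<Theta> \<Phi> by (simp add: ennreal_mult)
    finally show ?thesis
      by (subst (asm) ennreal_le_iff) (use A pos \<Theta> \<Phi> in auto)
  qed
  \<comment> \<open>\<open>20 = 2 * 2 * 5\<close>: the factor of \<open>difference_bound\<close>, the two negative powers of \<open>c\<close>, and
    the two weights compared by \<open>weight_shift\<close>; \<open>256 = 4 ^ 4\<close> comes from \<open>far_weight\<close>\<close>
  define D where "D = A * (20 * C * K * L) * \<Theta> + 256 * C * \<Phi>"
  have D: "D \<ge> 0" using A C K L \<Theta> \<Phi> by (simp add: D_def)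
  show thesis
  proof (rule that[of D])
    show "D \<ge> 0" by (rule D)
    fix t :: real and x :: vec3
    assume t: "0 \<le> t" "t \<le> T" and x: "1 + 4 * R \<le> norm x" and conv: "duhamel_converges \<nu> F x t"
    let ?c = "\<lambda>s. diffusion_length \<nu> (t - s)" and ?W = "(1 + norm x) powr (-7/4)"
    have c: "?c s > 0" if "s < t" for s using that \<open>\<nu> > 0\<close> by (simp add: diffusion_length_pos)
    show "norm (duhamel_term \<nu> F x t) \<le> D * ?W"
    proof -
      let ?k = "\<lambda>s y. C * (?c s + norm (x - y)) powr (-3)"
      have "norm (duhamel_term \<nu> F x t) \<le> A * (2 * C * K * L * ?W) * \<Theta> + (64 * C * ?W) * \<Phi>"
        unfolding duhamel_term_def
      proof (rule core[OF t, where I = "\<lambda>s y. NS_kernel \<nu> (x - y) (t - s) *v F y s" and k = ?k])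
        show "AE s in lborel. s \<in> {0..t} \<longrightarrow>
            ennreal (norm (\<integral>y. NS_kernel \<nu> (x - y) (t - s) *v F y s \<partial>lborel))
            \<le> (\<integral>\<^sup>+ y. ennreal (norm (NS_kernel \<nu> (x - y) (t - s) *v F y s)) \<partial>lborel)"
          using conv unfolding duhamel_converges_def
          by (auto intro: integral_norm_bound_ennreal elim!: eventually_mono)
        show "set_integrable lborel {0..t} (\<lambda>s. \<integral>y. NS_kernel \<nu> (x - y) (t - s) *v F y s \<partial>lborel)"
          using conv by (simp add: duhamel_converges_def)
        fix s assume s: "0 \<le> s" "s < t"
        show "?k s \<in> borel_measurable borel" by simp
        show "(\<integral>\<^sup>+ y. ennreal (?k s y * (1 + norm y) powr (-2)) \<partial>lborel)
            \<le> ennreal (2 * C * K * L * ?W * (t - s) powr (-5/8))"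
        proof -
          have 1: "?c s powr (-1/4) + 1 \<le> 2 * L * (t - s) powr (-5/8)"
            using L(2)[of "t - s" "1/4"] L(2)[of "t - s" 0] s t c[OF s(2)] by simp
          have "(\<integral>\<^sup>+ y. ennreal (?k s y * (1 + norm y) powr (-2)) \<partial>lborel)
              = ennreal C * (\<integral>\<^sup>+ y. ennreal ((?c s + norm (x - y)) powr (-3) * (1 + norm y) powr (-2)) \<partial>lborel)"
            using C by (subst nn_integral_cmult[symmetric]) (auto simp: mult.assoc ennreal_mult)
          also have "\<dots> \<le> ennreal C * ennreal (K * (?c s powr (-1/4) + 1) * ?W)"
            using K(2)[OF c[OF s(2)], of x] by (intro mult_left_mono) auto
          also have "\<dots> = ennreal (C * (K * (?c s powr (-1/4) + 1) * ?W))"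
            using C K by (intro ennreal_mult[symmetric]) auto
          also have "\<dots> \<le> ennreal (C * (K * (2 * L * (t - s) powr (-5/8)) * ?W))"
            using C K by (intro ennreal_leI mult_left_mono mult_right_mono 1) auto
          finally show ?thesis by (simp add: mult_ac)
        qed
        fix y
        show "0 \<le> ?k s y" using C by simp
        show "norm (NS_kernel \<nu> (x - y) (t - s) *v F y s) \<le> ?k s y * norm (F y s)"
          using G[of "t - s"] s by simp
        assume y: "norm y \<le> R"
        have "?k s y \<le> C * (4 powr 3 * ?W)"
          using far_weight[OF y x, of "?c s" 3] c[OF s(2)] C by (intro mult_left_mono) auto
        then show "norm (NS_kernel \<nu> (x - y) (t - s) *v F y s) \<le> 64 * C * ?W * norm (F y s)"
          using G[of "t - s" "x - y" "F y s"] s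
          by (intro order.trans[OF G] mult_right_mono) auto
      qed (use C K L in auto)
      also have "\<dots> = (A * (2 * C * K * L) * \<Theta> + 64 * C * \<Phi>) * ?W" by (simp add: algebra_simps)
      also have "\<dots> \<le> D * ?W"
        unfolding D_def using A C K L \<Theta> \<Phi>
        by (intro mult_right_mono add_mono mult_left_mono) auto
      finally show ?thesis .
    qed
    fix x' :: vec3
    assume near: "norm (x' - x) \<le> 1/4" and conv': "duhamel_converges \<nu> F x' t"
    let ?h = "norm (x' - x)"
    show "norm (duhamel_term \<nu> F x' t - duhamel_term \<nu> F x t) \<le> D * ?h * ?W"
    proof -
      let ?k = "\<lambda>s y. 2 * C * ?h / ?c s * ((?c s + norm (x - y)) powr (-3) + (?c s + norm (x' - y)) powr (-3))"
      let ?I = "\<lambda>s y. NS_kernel \<nu> (x' - y) (t - s) *v F y s - NS_kernel \<nu> (x - y) (t - s) *v F y s"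
      let ?J = "\<lambda>x s. \<integral>y. NS_kernel \<nu> (x - y) (t - s) *v F y s \<partial>lborel"
      have "norm (LBINT s:{0..t}. ?J x' s - ?J x s) \<le> A * (20 * C * ?h * K * L * ?W) * \<Theta> + (256 * C * ?h * ?W) * \<Phi>"
      proof (rule core[OF t, where I = ?I and k = ?k])
        have "AE s in lborel. s \<in> {0..t} \<longrightarrow> integrable lborel (\<lambda>y. NS_kernel \<nu> (x - y) (t - s) *v F y s)"
          "AE s in lborel. s \<in> {0..t} \<longrightarrow> integrable lborel (\<lambda>y. NS_kernel \<nu> (x' - y) (t - s) *v F y s)"
          using conv conv' by (auto simp: duhamel_converges_def)
        then show "AE s in lborel. s \<in> {0..t} \<longrightarrow>
            ennreal (norm (?J x' s - ?J x s)) \<le> (\<integral>\<^sup>+ y. ennreal (norm (?I s y)) \<partial>lborel)"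
        proof eventually_elim
          case (elim s)
          show ?case
          proof
            assume s: "s \<in> {0..t}"
            have "?J x' s - ?J x s = (\<integral>y. ?I s y \<partial>lborel)"
              using elim s by (intro Bochner_Integration.integral_diff[symmetric]) auto
            then show "ennreal (norm (?J x' s - ?J x s)) \<le> (\<integral>\<^sup>+ y. ennreal (norm (?I s y)) \<partial>lborel)"
              using elim s by (simp only:) (intro integral_norm_bound_ennreal, auto)
          qed
        qed
        show "set_integrable lborel {0..t} (\<lambda>s. ?J x' s - ?J x s)"
          using conv conv' by (intro set_integral_diff) (auto simp: duhamel_converges_def)
        fix s assume s: "0 \<le> s" "s < t"
        show "?k s \<in> borel_measurable borel" by simp
        show "(\<integral>\<^sup>+ y. ennreal (?k s y * (1 + norm y) powr (-2)) \<partial>lborel)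
            \<le> ennreal (20 * C * ?h * K * L * ?W * (t - s) powr (-5/8))"
        proof -
          let ?W' = "(1 + norm x') powr (-7/4)"
          have W': "?W' \<le> 4 * ?W" using near by (intro weight_shift) simp
          have "1 / ?c s * (?c s powr (-1/4) + 1) = ?c s powr (-(5/4)) + ?c s powr (-1)"
            using c[OF s(2)] powr_add[of "?c s" "-1" "-1/4"]
            by (simp add: powr_minus_divide algebra_simps)
          also have "\<dots> \<le> 2 * L * (t - s) powr (-5/8)"
            using L(2)[of "t - s" "5/4"] L(2)[of "t - s" 1] s t by simp
          finally have 1: "1 / ?c s * (?c s powr (-1/4) + 1) \<le> 2 * L * (t - s) powr (-5/8)" .
          have "(\<integral>\<^sup>+ y. ennreal (?k s y * (1 + norm y) powr (-2)) \<partial>lborel)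
              = (\<integral>\<^sup>+ y. ennreal (2 * C * ?h / ?c s) *
                  (ennreal ((?c s + norm (x - y)) powr (-3) * (1 + norm y) powr (-2))
                   + ennreal ((?c s + norm (x' - y)) powr (-3) * (1 + norm y) powr (-2))) \<partial>lborel)"
            using C c[OF s(2)]
            by (intro nn_integral_cong) (simp add: algebra_simps add_divide_distrib flip: ennreal_plus ennreal_mult)
          also have "\<dots> = ennreal (2 * C * ?h / ?c s) *
              ((\<integral>\<^sup>+ y. ennreal ((?c s + norm (x - y)) powr (-3) * (1 + norm y) powr (-2)) \<partial>lborel)
               + (\<integral>\<^sup>+ y. ennreal ((?c s + norm (x' - y)) powr (-3) * (1 + norm y) powr (-2)) \<partial>lborel))"
            by (simp add: nn_integral_cmult nn_integral_add)
          also have "\<dots> \<le> ennreal (2 * C * ?h / ?c s) *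
              (ennreal (K * (?c s powr (-1/4) + 1) * ?W) + ennreal (K * (?c s powr (-1/4) + 1) * ?W'))"
            by (intro mult_left_mono add_mono K c s) auto
          also have "\<dots> = ennreal (2 * C * ?h / ?c s * (K * (?c s powr (-1/4) + 1) * ?W + K * (?c s powr (-1/4) + 1) * ?W'))"
            using C K c[OF s(2)] by (simp flip: ennreal_plus ennreal_mult)
          also have "\<dots> = ennreal ((2 * C * ?h * K) * (1 / ?c s * (?c s powr (-1/4) + 1)) * (?W + ?W'))"
            by (simp add: algebra_simps add_divide_distrib)
          also have "\<dots> \<le> ennreal ((2 * C * ?h * K) * (2 * L * (t - s) powr (-5/8)) * (5 * ?W))"
            using C K L W' c[OF s(2)] by (intro ennreal_leI mult_mono mult_left_mono 1) auto
          finally show ?thesis by (simp add: mult_ac)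
        qed
        fix y
        show "0 \<le> ?k s y" using C c[OF s(2)] by simp
        show "norm (?I s y) \<le> ?k s y * norm (F y s)"
        proof -
          have "norm (?I s y) \<le> 2 * (C * norm (F y s)) * norm ((x' - y) - (x - y)) / ?c s *
              ((?c s + norm (x - y)) powr (-3) + (?c s + norm (x' - y)) powr (-3))"
            using G[of "t - s" _ "F y s"] G'[of "t - s" _ _ "F y s"] s C
            by (intro difference_bound[OF c[OF s(2)], where \<phi> = "\<lambda>z. NS_kernel \<nu> z (t - s) *v F y s"])
               (auto simp: mult_ac)
          then show ?thesis by (simp add: mult_ac)
        qed
        assume y: "norm y \<le> R"
        have "2 * norm (x' - x) \<le> ?c s + norm (x - y)"
          using near y x c[OF s(2)] norm_triangle_ineq2[of x y] norm_ge_zero[of y] by linarith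
        then have "norm ((x' - y) - (x - y)) \<le> (?c s + norm (x - y)) / 2" by simp
        then have "norm (?I s y) \<le> C * ?h * (?c s + norm (x - y)) powr (-4) * norm (F y s)"
          using G'[of "t - s" "x' - y" "x - y" "F y s"] s by simp
        also have "\<dots> \<le> C * ?h * (4 powr 4 * ?W) * norm (F y s)"
          using far_weight[OF y x, of "?c s" 4] c[OF s(2)] C by (intro mult_right_mono mult_left_mono) auto
        finally show "norm (?I s y) \<le> 256 * C * ?h * ?W * norm (F y s)" by (simp add: mult_ac)
      qed (use C K L in auto)
      also have "\<dots> = D * ?h * ?W" by (simp add: D_def algebra_simps)
      also have "(LBINT s:{0..t}. ?J x' s - ?J x s) = duhamel_term \<nu> F x' t - duhamel_term \<nu> F x t"
        unfolding duhamel_term_def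
        using conv conv' by (intro set_integral_diff) (auto simp: duhamel_converges_def)
      finally show ?thesis .
    qed
  qed
qed

section \<open>Decay of the heat flow\<close>

text \<open>
  For the size, one of \<open>c + |x - y|\<close> and \<open>1 + |y|\<close> is at least half of \<open>1 + |x|\<close>, and whichever it is leaves
  the other factor, a kernel or a datum, with a bounded integral. No negative power of \<open>t\<close> appears, so the bound holds uniformly down
  to \<open>t = 0\<close>. For the differences a singularity in time is acceptable, and
  the heat kernel is treated like the Navier--Stokes kernel.
\<close>

lemma heat_flow_decay:
  assumes "\<nu> > 0" "q > 3" and w: "w \<in> borel_measurable borel"
    and wD: "\<And>y. norm (w y) \<le> D * (1 + norm y) powr (-q)"
  obtains C where "C \<ge> 0"
    "\<And>t x. t \<ge> 0 \<Longrightarrow> norm (heat_flow \<nu> w x t) \<le> C * (1 + norm x) powr (-7/4)"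
    "\<And>t x x'. t > 0 \<Longrightarrow> norm (x' - x) \<le> 1/2 \<Longrightarrow>
       norm (heat_flow \<nu> w x' t - heat_flow \<nu> w x t)
       \<le> C * norm (x' - x) * (diffusion_length \<nu> t powr (-5/4) + diffusion_length \<nu> t powr (-1))
           * (1 + norm x) powr (-7/4)"
proof -
  obtain H where H: "H \<ge> 0"
    and g: "\<And>t z. t > 0 \<Longrightarrow> \<bar>heat_kernel \<nu> z t\<bar>
       \<le> H * diffusion_length \<nu> t * (diffusion_length \<nu> t + norm z) powr (-4)"
    and g': "\<And>t z z'. t > 0 \<Longrightarrow> norm (z' - z) \<le> (diffusion_length \<nu> t + norm z) / 2 \<Longrightarrow>
       \<bar>heat_kernel \<nu> z' t - heat_kernel \<nu> z t\<bar>
       \<le> H * norm (z' - z) * (diffusion_length \<nu> t + norm z) powr (-4)"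
    using heat_kernel_bounds \<open>\<nu> > 0\<close> by metis
  obtain K where K: "K \<ge> 0" "\<And>c x. c > 0 \<Longrightarrow>
       (\<integral>\<^sup>+ y. ennreal ((c + norm (x - y :: vec3)) powr (-3) * (1 + norm y) powr (-2)) \<partial>lborel)
       \<le> ennreal (K * (c powr (-1/4) + 1) * (1 + norm x) powr (-7/4))"
    using convolution_decay by blast
  obtain J where J: "J \<ge> 0" "\<And>c x. c > 0 \<Longrightarrow>
      (\<integral>\<^sup>+ y. ennreal ((c + norm (x - y :: vec3)) powr (- 4)) \<partial>lborel) \<le> ennreal (J * c powr (3 - 4))"
    using nn_integral_decay[of 4] by auto
  obtain Q where Q: "Q \<ge> 0" "\<And>c x. c > 0 \<Longrightarrow>
      (\<integral>\<^sup>+ y. ennreal ((c + norm (x - y :: vec3)) powr (- q)) \<partial>lborel) \<le> ennreal (Q * c powr (3 - q))"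
    using nn_integral_decay[OF \<open>q > 3\<close>] by auto
  have D: "D \<ge> 0" using order.trans[OF norm_ge_zero wD[of 0]] by simp
  have weaken: "r powr (-q) \<le> r powr (-2)" "r powr (-q) \<le> r powr (-3)" "r powr (-3) \<le> r powr (-7/4)"
    if "r \<ge> 1" for r :: real
    using that \<open>q > 3\<close> by (auto intro!: powr_mono)
  define C where "C = D + 8 * H * D * (J + Q) + 10 * H * D * K"
  have C0: "8 * H * D * (J + Q) \<ge> 0" "10 * H * D * K \<ge> 0" using H D J Q K by auto
  have [measurable]: "(\<lambda>y. heat_kernel \<nu> (x - y) t) \<in> borel_measurable borel" for x t
    unfolding heat_kernel_def by measurable
  note [measurable] = w
  have size: "ennreal (norm (\<integral>y. heat_kernel \<nu> (x - y) t *\<^sub>R w y \<partial>lborel)) \<le> ennreal (8 * H * D * (J + Q) * (1 + norm x) powr (-3))"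
    and int: "integrable lborel (\<lambda>y. heat_kernel \<nu> (x - y) t *\<^sub>R w y)" if t: "t > 0" for t x
  proof -
    let ?c = "diffusion_length \<nu> t"
    have c: "?c > 0" using t \<open>\<nu> > 0\<close> by (simp add: diffusion_length_pos)
    let ?a = "\<lambda>y. ?c + norm (x - y)" and ?b = "\<lambda>y::vec3. 1 + norm y" and ?W = "1 + norm x"
    have split: "(?c * ?a y powr (-4)) * ?b y powr (-q)
        \<le> 8 * ?W powr (-3) * (?c * ?a y powr (-4) + ?b y powr (-q))" for y
    proof -
      have "norm x \<le> norm (x - y) + norm y" using norm_triangle_sub[of x y] by (simp add: add.commute)
      then have "?W / 2 \<le> ?a y \<or> ?W / 2 \<le> ?b y" using c by auto
      moreover have half: "r powr (-3) \<le> 8 * ?W powr (-3)" if "?W / 2 \<le> r" for r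
      proof -
        have "r powr (-3) \<le> (?W / 2) powr (-3)"
          using that by (intro powr_mono2') (auto simp: add_pos_nonneg)
        then show ?thesis by (simp add: powr_divide powr_minus field_simps)
      qed
      moreover have "?c * ?a y powr (-4) \<le> ?a y powr (-3)"
      proof -
        have "?c * ?a y powr (-4) \<le> ?a y powr 1 * ?a y powr (-4)"
          using c by (intro mult_right_mono) auto
        then show ?thesis by (simp flip: powr_add del: powr_one' powr_one_gt_zero_iff)
      qed
      moreover have "?b y powr (-q) \<le> ?b y powr (-3)" by (intro weaken) simp
      ultimately consider "?c * ?a y powr (-4) \<le> 8 * ?W powr (-3)" | "?b y powr (-q) \<le> 8 * ?W powr (-3)"
        by (meson order.trans)
      then show ?thesis
      proof cases
        case 1
        then have "(?c * ?a y powr (-4)) * ?b y powr (-q) \<le> 8 * ?W powr (-3) * ?b y powr (-q)"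
          by (rule mult_right_mono) simp
        also have "\<dots> \<le> 8 * ?W powr (-3) * (?c * ?a y powr (-4) + ?b y powr (-q))"
          using c by (intro mult_left_mono) auto
        finally show ?thesis .
      next
        case 2
        then have "(?c * ?a y powr (-4)) * ?b y powr (-q) \<le> (?c * ?a y powr (-4)) * (8 * ?W powr (-3))"
          using c by (intro mult_left_mono) auto
        also have "\<dots> \<le> (?c * ?a y powr (-4) + ?b y powr (-q)) * (8 * ?W powr (-3))"
          by (intro mult_right_mono) auto
        finally show ?thesis by (simp add: mult_ac)
      qed
    qed
    have pw: "norm (heat_kernel \<nu> (x - y) t *\<^sub>R w y)
        \<le> H * D * (8 * ?W powr (-3)) * (?c * ?a y powr (-4) + ?b y powr (-q))" for y
    proof -
      have "norm (heat_kernel \<nu> (x - y) t *\<^sub>R w y) \<le> (H * ?c * ?a y powr (-4)) * (D * ?b y powr (-q))"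
        unfolding norm_scaleR using H c by (intro mult_mono wD g t) auto
      also have "\<dots> = H * D * ((?c * ?a y powr (-4)) * ?b y powr (-q))" by simp
      also have "\<dots> \<le> H * D * (8 * ?W powr (-3) * (?c * ?a y powr (-4) + ?b y powr (-q)))"
        using H D by (intro mult_left_mono split) auto
      finally show ?thesis by (simp add: mult_ac)
    qed
    have "(\<integral>\<^sup>+ y. ennreal (norm (heat_kernel \<nu> (x - y) t *\<^sub>R w y)) \<partial>lborel)
        \<le> (\<integral>\<^sup>+ y. ennreal (H * D * (8 * ?W powr (-3))) * (ennreal ?c * ennreal (?a y powr (-4)) + ennreal (?b y powr (-q))) \<partial>lborel)"
      using H D c by (intro nn_integral_mono order.trans[OF ennreal_leI[OF pw]])
         (simp flip: ennreal_plus ennreal_mult)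
    also have "\<dots> = ennreal (H * D * (8 * ?W powr (-3))) *
        (ennreal ?c * (\<integral>\<^sup>+ y. ennreal (?a y powr (-4)) \<partial>lborel) + (\<integral>\<^sup>+ y. ennreal (?b y powr (-q)) \<partial>lborel))"
      by (simp add: nn_integral_cmult nn_integral_add)
    also have "\<dots> \<le> ennreal (H * D * (8 * ?W powr (-3))) * (ennreal ?c * ennreal (J * ?c powr (3 - 4)) + ennreal (Q * 1 powr (3 - q)))"
      using J(2)[OF c, of x] Q(2)[of 1 0] by (intro mult_left_mono add_mono) auto
    also have "ennreal ?c * ennreal (J * ?c powr (3 - 4)) = ennreal J"
      using c J by (simp add: powr_minus_divide flip: ennreal_mult)
    also have "ennreal (H * D * (8 * ?W powr (-3))) * (ennreal J + ennreal (Q * 1 powr (3 - q)))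
        = ennreal (8 * H * D * (J + Q) * ?W powr (-3))"
      using H D J Q by (simp add: mult_ac flip: ennreal_plus ennreal_mult)
    finally have le: "(\<integral>\<^sup>+ y. ennreal (norm (heat_kernel \<nu> (x - y) t *\<^sub>R w y)) \<partial>lborel)
        \<le> ennreal (8 * H * D * (J + Q) * ?W powr (-3))" .
    show int: "integrable lborel (\<lambda>y. heat_kernel \<nu> (x - y) t *\<^sub>R w y)"
    proof (rule integrableI_bounded)
      show "(\<integral>\<^sup>+ y. ennreal (norm (heat_kernel \<nu> (x - y) t *\<^sub>R w y)) \<partial>lborel) < \<infinity>"
        using le by (rule order.strict_trans1) simp
    qed measurable
    show "ennreal (norm (\<integral>y. heat_kernel \<nu> (x - y) t *\<^sub>R w y \<partial>lborel)) \<le> ennreal (8 * H * D * (J + Q) * ?W powr (-3))"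
      using integral_norm_bound_ennreal[OF int] le by (rule order.trans)
  qed
  show thesis
  proof (rule that[of C])
    show "C \<ge> 0" using C0 D by (simp add: C_def)
    show "norm (heat_flow \<nu> w x t) \<le> C * (1 + norm x) powr (-7/4)" if t: "t \<ge> 0" for t x
    proof (cases "t = 0")
      case True
      have "norm (w x) \<le> D * (1 + norm x) powr (-7/4)"
        using weaken[of "1 + norm x"] D by (intro order.trans[OF wD] mult_left_mono) auto
      also have "\<dots> \<le> C * (1 + norm x) powr (-7/4)"
        using C0 by (intro mult_right_mono) (auto simp: C_def)
      finally show ?thesis using True by (simp add: heat_flow_def)
    next
      case False
      then have "norm (heat_flow \<nu> w x t) \<le> 8 * H * D * (J + Q) * (1 + norm x) powr (-3)"
        using size[of t x] C0 t by (simp add: heat_flow_def)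
      also have "\<dots> \<le> C * (1 + norm x) powr (-7/4)"
        using weaken[of "1 + norm x"] C0 D by (intro mult_mono) (auto simp: C_def)
      finally show ?thesis .
    qed
    fix t :: real and x x' :: vec3
    assume t: "t > 0" and near: "norm (x' - x) \<le> 1/2"
    let ?c = "diffusion_length \<nu> t" and ?h = "norm (x' - x)"
      and ?W = "(1 + norm x) powr (-7/4)" and ?W' = "(1 + norm x') powr (-7/4)"
    have c: "?c > 0" using t \<open>\<nu> > 0\<close> by (simp add: diffusion_length_pos)
    have pw: "norm (heat_kernel \<nu> (x' - y) t *\<^sub>R w y - heat_kernel \<nu> (x - y) t *\<^sub>R w y)
        \<le> (2 * H * ?h / ?c * D) * ((?c + norm (x - y)) powr (-3) * (1 + norm y) powr (-2)
            + (?c + norm (x' - y)) powr (-3) * (1 + norm y) powr (-2))" for y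
    proof -
      have "norm (heat_kernel \<nu> (x' - y) t - heat_kernel \<nu> (x - y) t)
          \<le> 2 * H * norm ((x' - y) - (x - y)) / ?c * ((?c + norm (x - y)) powr (-3) + (?c + norm (x' - y)) powr (-3))"
      proof (rule difference_bound[OF c H, where \<phi> = "\<lambda>z. heat_kernel \<nu> z t"])
        fix z :: vec3
        have "?c * (?c + norm z) powr (-4) \<le> (?c + norm z) powr 1 * (?c + norm z) powr (-4)"
          using c by (intro mult_right_mono) auto
        also have "\<dots> = (?c + norm z) powr (-3)" by (simp only: flip: powr_add) simp
        finally have "H * (?c * (?c + norm z) powr (-4)) \<le> H * (?c + norm z) powr (-3)"
          using H by (rule mult_left_mono)
        then have "H * ?c * (?c + norm z) powr (-4) \<le> H * (?c + norm z) powr (-3)"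
          by (simp only: mult.assoc)
        with g[OF t, of z] show "norm (heat_kernel \<nu> z t) \<le> H * (?c + norm z) powr (-3)"
          unfolding real_norm_def by (rule order.trans)
      qed (use g'[OF t] in auto)
      moreover have "norm (w y) \<le> D * (1 + norm y) powr (-2)"
        using weaken[of "1 + norm y"] D by (intro order.trans[OF wD] mult_left_mono) auto
      ultimately have "norm ((heat_kernel \<nu> (x' - y) t - heat_kernel \<nu> (x - y) t) *\<^sub>R w y)
          \<le> (2 * H * ?h / ?c * ((?c + norm (x - y)) powr (-3) + (?c + norm (x' - y)) powr (-3)))
             * (D * (1 + norm y) powr (-2))"
        unfolding norm_scaleR using H c by (intro mult_mono) auto
      then show ?thesis by (simp add: scaleR_diff_left algebra_simps)
    qed
    have W': "?W' \<le> 4 * ?W" using near by (rule weight_shift)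
    have pre: "2 * H * ?h / ?c * D \<ge> 0" using H D c by auto
    have "heat_flow \<nu> w x' t - heat_flow \<nu> w x t
        = (\<integral>y. heat_kernel \<nu> (x' - y) t *\<^sub>R w y - heat_kernel \<nu> (x - y) t *\<^sub>R w y \<partial>lborel)"
      using t by (simp add: heat_flow_def int)
    then have "ennreal (norm (heat_flow \<nu> w x' t - heat_flow \<nu> w x t))
        \<le> (\<integral>\<^sup>+ y. ennreal (norm (heat_kernel \<nu> (x' - y) t *\<^sub>R w y - heat_kernel \<nu> (x - y) t *\<^sub>R w y)) \<partial>lborel)"
      using int[OF t] by (simp only:) (intro integral_norm_bound_ennreal Bochner_Integration.integrable_diff)
    also have "\<dots> \<le> (\<integral>\<^sup>+ y. ennreal (2 * H * ?h / ?c * D) *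
        (ennreal ((?c + norm (x - y)) powr (-3) * (1 + norm y) powr (-2))
         + ennreal ((?c + norm (x' - y)) powr (-3) * (1 + norm y) powr (-2))) \<partial>lborel)"
      using pre by (intro nn_integral_mono order.trans[OF ennreal_leI[OF pw]])
        (simp flip: ennreal_plus ennreal_mult)
    also have "\<dots> = ennreal (2 * H * ?h / ?c * D) *
        ((\<integral>\<^sup>+ y. ennreal ((?c + norm (x - y)) powr (-3) * (1 + norm y) powr (-2)) \<partial>lborel)
         + (\<integral>\<^sup>+ y. ennreal ((?c + norm (x' - y)) powr (-3) * (1 + norm y) powr (-2)) \<partial>lborel))"
      by (simp add: nn_integral_cmult nn_integral_add)
    also have "\<dots> \<le> ennreal (2 * H * ?h / ?c * D) *
        (ennreal (K * (?c powr (-1/4) + 1) * ?W) + ennreal (K * (?c powr (-1/4) + 1) * ?W'))"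
      by (intro mult_left_mono add_mono K c) auto
    also have "\<dots> = ennreal (2 * H * ?h / ?c * D * (K * (?c powr (-1/4) + 1) * (?W + ?W')))"
      using pre K by (simp add: distrib_left flip: ennreal_plus ennreal_mult)
    finally have "norm (heat_flow \<nu> w x' t - heat_flow \<nu> w x t)
        \<le> 2 * H * ?h / ?c * D * (K * (?c powr (-1/4) + 1) * (?W + ?W'))"
      by (subst (asm) ennreal_le_iff)
         (rule mult_nonneg_nonneg[OF pre], rule mult_nonneg_nonneg, rule mult_nonneg_nonneg, simp_all add: K)
    also have "\<dots> \<le> 2 * H * ?h / ?c * D * (K * (?c powr (-1/4) + 1) * (5 * ?W))"
      using pre K W' by (intro mult_left_mono) auto
    also have "\<dots> = 10 * H * D * K * (?h * ?W) * (1 / ?c * (?c powr (-1/4) + 1))" by simp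
    also have "1 / ?c * (?c powr (-1/4) + 1) = ?c powr (-5/4) + ?c powr (-1)"
      using c powr_add[of ?c "-1" "-1/4"] by (simp add: powr_minus_divide algebra_simps)
    also have "10 * H * D * K * (?h * ?W) * (?c powr (-5/4) + ?c powr (-1))
        \<le> C * (?h * ?W) * (?c powr (-5/4) + ?c powr (-1))"
      using C0 D by (intro mult_right_mono) (auto simp: C_def)
    finally show "norm (heat_flow \<nu> w x' t - heat_flow \<nu> w x t)
       \<le> C * ?h * (?c powr (-5/4) + ?c powr (-1)) * ?W" by (simp add: mult_ac)
  qed
qed

section \<open>Finite energy and dissipation\<close>

text \<open>
  The columns are limits of difference quotients along the axes, so an increment bound at a single point
  is enough; this is how gradient bounds are read off from the integral equation.
\<close>

lemma norm_jacobian_le: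
  fixes u :: vfield
  assumes "u differentiable (at x)" and \<delta>: "\<delta> > 0"
    and lip: "\<And>x'. norm (x' - x) \<le> \<delta> \<Longrightarrow> norm (u x' - u x) \<le> B * norm (x' - x)"
  shows "norm (jacobian u (at x)) \<le> 9 * B"
proof -
  let ?G = "jacobian u (at x)"
  have "(u has_derivative (\<lambda>h. ?G *v h)) (at x)" using assms(1) by (simp add: jacobian_works)
  have col: "norm (?G *v axis k 1) \<le> B" for k
  proof -
    let ?q = "\<lambda>r. (1 / r) *\<^sub>R (u (x + r *\<^sub>R axis k 1) - u x)"
    have "((\<lambda>r. x + r *\<^sub>R axis k 1) has_derivative (\<lambda>r. r *\<^sub>R axis k 1)) (at (0::real))"
      by (auto intro!: derivative_eq_intros)
    from has_derivative_compose[OF this, of u "\<lambda>h. ?G *v h"]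
    have "((\<lambda>r. u (x + r *\<^sub>R axis k 1)) has_derivative (\<lambda>r. r *\<^sub>R (?G *v axis k 1))) (at 0)"
      using \<open>(u has_derivative _) _\<close> by (simp add: matrix_vector_mult_scaleR)
    then have "((\<lambda>r. norm (u (x + r *\<^sub>R axis k 1) - u x - r *\<^sub>R (?G *v axis k 1)) / norm r) \<longlongrightarrow> 0) (at 0)"
      by (simp add: has_derivative_at)
    moreover have "\<forall>\<^sub>F r in at 0. norm (u (x + r *\<^sub>R axis k 1) - u x - r *\<^sub>R (?G *v axis k 1)) / norm r
        = norm (?q r - ?G *v axis k 1)"
      unfolding eventually_at_filter
    proof (intro always_eventually allI impI)
      fix r :: real assume r: "r \<noteq> 0"
      then have "?q r - ?G *v axis k 1 = (1 / r) *\<^sub>R (u (x + r *\<^sub>R axis k 1) - u x - r *\<^sub>R (?G *v axis k 1))"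
        by (simp add: scaleR_diff_right)
      then show "norm (u (x + r *\<^sub>R axis k 1) - u x - r *\<^sub>R (?G *v axis k 1)) / norm r
          = norm (?q r - ?G *v axis k 1)"
        by (simp only: norm_scaleR) simp
    qed
    ultimately have "((\<lambda>r. norm (?q r - ?G *v axis k 1)) \<longlongrightarrow> 0) (at 0)"
      by (rule Lim_transform_eventually)
    then have lim: "(?q \<longlongrightarrow> ?G *v axis k 1) (at 0)"
      by (rule LIM_zero_cancel[OF tendsto_norm_zero_cancel])
    have "\<forall>\<^sub>F r in at (0::real). norm ((1 / r) *\<^sub>R (u (x + r *\<^sub>R axis k 1) - u x)) \<le> B"
      unfolding eventually_at
    proof (intro exI[of _ \<delta>] conjI ballI impI \<delta>)
      fix r :: real assume r: "r \<noteq> 0 \<and> dist r 0 < \<delta>"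
      then have "norm (u (x + r *\<^sub>R axis k 1) - u x) \<le> B * \<bar>r\<bar>"
        using lip[of "x + r *\<^sub>R axis k 1"] by (simp add: dist_norm)
      then show "norm ((1 / r) *\<^sub>R (u (x + r *\<^sub>R axis k 1) - u x)) \<le> B"
        unfolding norm_scaleR using r by (simp add: field_simps)
    qed
    then show ?thesis by (rule tendsto_upperbound[OF tendsto_norm[OF lim]]) simp
  qed
  have "norm (?G $ i) \<le> 3 * B" for i
  proof -
    have "norm (?G $ i) \<le> (\<Sum>k\<in>UNIV. \<bar>?G $ i $ k\<bar>)" by (rule norm_le_l1_cart)
    also have "\<dots> \<le> (\<Sum>k\<in>(UNIV :: 3 set). B)"
    proof (rule sum_mono)
      fix k
      have "?G $ i $ k = (?G *v axis k 1) $ i" by (simp add: matrix_vector_mult_basis column_def)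
      then show "\<bar>?G $ i $ k\<bar> \<le> B" using component_le_norm_cart[of "?G *v axis k 1" i] col[of k] by simp
    qed
    finally show ?thesis by simp
  qed
  then have "(\<Sum>i\<in>UNIV. norm (?G $ i)) \<le> (\<Sum>i\<in>(UNIV :: 3 set). 3 * B)" by (rule sum_mono)
  moreover have "norm ?G \<le> (\<Sum>i\<in>UNIV. norm (?G $ i))"
    unfolding norm_vec_def[of ?G] by (rule L2_set_le_sum) simp
  ultimately show ?thesis by simp
qed

text \<open>
  The bound \<open>t^(-5/8) |x|^(-7/4)\<close> on the gradient is square integrable in space but not in time, while the
  a priori bound \<open>|x|^(-1)\<close> is bounded in time but not square integrable in space. The interpolation
  \<open>|\<nabla>v|\<^sup>2 = |\<nabla>v|^(3/2) |\<nabla>v|^(1/2)\<close> gives \<open>t^(-15/16) |x|^(-25/8)\<close>, which is integrable in both.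
\<close>

lemma energy_class_bounds:
  fixes v :: tvfield
  assumes "T > 0" "M \<ge> 0" "C \<ge> 0" "D \<ge> 0"
    and v: "\<And>t x. 0 \<le> t \<Longrightarrow> t \<le> T \<Longrightarrow> norm (v x t) \<le> C * (1 + norm x) powr (-7/4)"
    and grad: "\<And>t x. 0 < t \<Longrightarrow> t \<le> T \<Longrightarrow> norm (grad v x t) \<le> M * (1 + norm x) powr (-1)"
      "\<And>t x. 0 < t \<Longrightarrow> t \<le> T \<Longrightarrow> norm (grad v x t) \<le> D * t powr (-5/8) * (1 + norm x) powr (-7/4)"
  shows "(SUP t\<in>{0..T}. energy v t) < \<infinity>"
    and "(\<integral>\<^sup>+ t\<in>{0..T}. grad_norm_sq v t \<partial>lborel) < \<infinity>"
proof -
  obtain K where K: "K \<ge> 0" "\<And>c x. c > 0 \<Longrightarrow>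
      (\<integral>\<^sup>+ y. ennreal ((c + norm (x - y :: vec3)) powr (- (7/2))) \<partial>lborel) \<le> ennreal (K * c powr (3 - 7/2))"
    using nn_integral_decay[of "7/2"] by auto
  have "energy v t \<le> ennreal (C\<^sup>2) * ennreal K" if t: "t \<in> {0..T}" for t
  proof -
    have "energy v t \<le> (\<integral>\<^sup>+ x. ennreal (C\<^sup>2) * ennreal ((1 + norm (x :: vec3)) powr (-(7/2))) \<partial>lborel)"
      unfolding energy_def
    proof (rule nn_integral_mono)
      fix x :: vec3
      have "(norm (v x t))\<^sup>2 \<le> (C * (1 + norm x) powr (-7/4))\<^sup>2"
        using v[of t x] t by (intro power_mono) auto
      also have "\<dots> = C\<^sup>2 * ((1 + norm x) powr (-7/4) * (1 + norm x) powr (-7/4))"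
        by (simp add: power2_eq_square)
      also have "(1 + norm x) powr (-7/4) * (1 + norm x) powr (-7/4) = (1 + norm x) powr (-(7/2))"
        by (simp only: flip: powr_add) simp
      finally show "ennreal ((norm (v x t))\<^sup>2) \<le> ennreal (C\<^sup>2) * ennreal ((1 + norm (x :: vec3)) powr (-(7/2)))"
        by (simp add: ennreal_leI flip: ennreal_mult)
    qed
    also have "\<dots> = ennreal (C\<^sup>2) * (\<integral>\<^sup>+ x. ennreal ((1 + norm (x :: vec3)) powr (-(7/2))) \<partial>lborel)"
      by (rule nn_integral_cmult) simp
    also have "\<dots> \<le> ennreal (C\<^sup>2) * ennreal K"
      using K(2)[of 1 0] by (intro mult_left_mono) auto
    finally show ?thesis .
  qed
  then have "(SUP t\<in>{0..T}. energy v t) \<le> ennreal (C\<^sup>2) * ennreal K" by (rule SUP_least)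
  also have "\<dots> < \<infinity>" by (simp flip: ennreal_mult')
  finally show "(SUP t\<in>{0..T}. energy v t) < \<infinity>" .
  obtain N where N: "N \<ge> 0" "\<And>c x. c > 0 \<Longrightarrow>
      (\<integral>\<^sup>+ y. ennreal ((c + norm (x - y :: vec3)) powr (- (25/8))) \<partial>lborel) \<le> ennreal (N * c powr (3 - 25/8))"
    using nn_integral_decay[of "25/8"] by auto
  define P where "P = D powr (3/2) * M powr (1/2)"
  have slice: "grad_norm_sq v t \<le> ennreal (P * N) * ennreal (t powr (-(15/16)))" if t: "0 < t" "t \<le> T" for t
  proof -
    have "grad_norm_sq v t \<le> (\<integral>\<^sup>+ x. ennreal (P * t powr (-(15/16))) * ennreal ((1 + norm (x :: vec3)) powr (-(25/8))) \<partial>lborel)"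
      unfolding grad_norm_sq_def
    proof (rule nn_integral_mono)
      fix x :: vec3
      let ?g = "norm (grad v x t)" and ?W = "1 + norm x"
      have "(\<Sum>j\<in>UNIV. inner (grad v x t $ j) (grad v x t $ j)) = ?g\<^sup>2"
        by (simp add: power2_norm_eq_inner inner_vec_def)
      also have "\<dots> = ?g powr (3/2) * ?g powr (1/2)"
        by (simp only: flip: powr_add) simp
      also have "\<dots> \<le> (D * t powr (-5/8) * ?W powr (-7/4)) powr (3/2) * (M * ?W powr (-1)) powr (1/2)"
        using grad[OF t, of x] by (intro mult_mono powr_mono2) auto
      also have "\<dots> = P * t powr (-(15/16)) * (?W powr (-(21/8)) * ?W powr (-(1/2)))"
        unfolding powr_mult powr_powr P_def by simp
      also have "?W powr (-(21/8)) * ?W powr (-(1/2)) = ?W powr (-(25/8))"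
        by (simp only: flip: powr_add) simp
      finally show "ennreal (\<Sum>j\<in>UNIV. inner (grad v x t $ j) (grad v x t $ j))
          \<le> ennreal (P * t powr (-(15/16))) * ennreal (?W powr (-(25/8)))"
        by (simp add: P_def ennreal_leI flip: ennreal_mult)
    qed
    also have "\<dots> = ennreal (P * t powr (-(15/16))) * (\<integral>\<^sup>+ x. ennreal ((1 + norm (x :: vec3)) powr (-(25/8))) \<partial>lborel)"
      by (rule nn_integral_cmult) simp
    also have "\<dots> \<le> ennreal (P * t powr (-(15/16))) * ennreal N"
      using N(2)[of 1 0] by (intro mult_left_mono) auto
    also have "\<dots> = ennreal (P * N) * ennreal (t powr (-(15/16)))"
      using N by (simp add: P_def mult_ac flip: ennreal_mult)
    finally show ?thesis .
  qed
  have "(\<integral>\<^sup>+ t\<in>{0..T}. grad_norm_sq v t \<partial>lborel)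
      \<le> (\<integral>\<^sup>+ t. ennreal (P * N) * (ennreal (t powr (-(15/16))) * indicator {0..T} t) \<partial>lborel)"
  proof (rule nn_integral_mono_AE)
    show "AE t in lborel. grad_norm_sq v t * indicator {0..T} t
        \<le> ennreal (P * N) * (ennreal (t powr (-(15/16))) * indicator {0..T} t)"
      using AE_lborel_singleton[of 0]
    proof eventually_elim
      case (elim t)
      then show ?case using slice[of t] by (auto simp: indicator_def)
    qed
  qed
  also have "\<dots> = ennreal (P * N) * ennreal (T powr (1 - 15/16) / (1 - 15/16))"
    using nn_integral_powr_singularity[of T "15/16"] \<open>T > 0\<close> by (simp add: nn_integral_cmult)
  also have "\<dots> < \<infinity>" by (simp add: ennreal_mult_less_top)
  finally show "(\<integral>\<^sup>+ t\<in>{0..T}. grad_norm_sq v t \<partial>lborel) < \<infinity>" .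
qed

text \<open>
  Lets a bound on the ball of radius \<open>\<rho>\<close> be restated as a decay estimate there.
\<close>

lemma powr_extend:
  fixes x :: vec3
  assumes "norm x \<le> \<rho>" "\<rho> \<ge> 0" "q \<ge> 0"
  shows "1 \<le> (1 + \<rho>) powr q * (1 + norm x) powr (-q)"
proof -
  have "(1 + norm x) powr q \<le> (1 + \<rho>) powr q" using assms by (intro powr_mono2) auto
  moreover have "0 < 1 + norm x" by (simp add: add_pos_nonneg)
  ultimately show ?thesis by (simp add: powr_minus_divide)
qed

text \<open>
  The asymptotic bound says nothing about a bounded region, so a separate uniform bound on \<open>u\<close> is needed there.
\<close>

lemma bigo_at_infinity_imp_global_decay:
  fixes u :: vfield
  assumes uM: "\<And>x. norm (u x) \<le> M" and M: "M \<ge> 0" and a: "a \<ge> 0"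
    and decay: "(\<lambda>x. norm (u x) + norm (jacobian u (at x))) \<in> O[at_infinity](\<lambda>x. (1 + norm x) powr (- a))"
  obtains D where "\<And>y. norm (u y) \<le> D * (1 + norm y) powr (-a)"
proof -
  obtain E where E: "E > 0" "\<forall>\<^sub>F x in at_infinity.
      norm (norm (u x) + norm (jacobian u (at x))) \<le> E * norm ((1 + norm x) powr (- a))"
    by (rule landau_o.bigE[OF decay])
  then obtain b where b: "\<And>x. b \<le> norm x \<Longrightarrow>
      norm (norm (u x) + norm (jacobian u (at x))) \<le> E * norm ((1 + norm x) powr (- a))"
    unfolding eventually_at_infinity by blast
  define D where "D = E + M * (1 + max b 0) powr a"
  have "norm (u y) \<le> D * (1 + norm y) powr (-a)" for y
  proof (cases "b \<le> norm y")
    case True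
    have "norm (u y) \<le> norm (u y) + norm (jacobian u (at y))" by simp
    also have "\<dots> \<le> E * (1 + norm y) powr (-a)" using b[OF True] by simp
    also have "\<dots> \<le> D * (1 + norm y) powr (-a)"
      using M by (intro mult_right_mono) (auto simp: D_def)
    finally show ?thesis .
  next
    case False
    have "norm (u y) \<le> M * 1" using uM by simp
    also have "\<dots> \<le> M * ((1 + max b 0) powr a * (1 + norm y) powr (-a))"
      using False a M by (intro mult_left_mono powr_extend) auto
    also have "\<dots> = (M * (1 + max b 0) powr a) * (1 + norm y) powr (-a)" by simp
    also have "\<dots> \<le> D * (1 + norm y) powr (-a)"
      using E by (intro mult_right_mono) (auto simp: D_def)
    finally show ?thesis .
  qed
  then show thesis by (rule that)
qed

text \<open>
  The a priori bounds \<open>|v|, |\<nabla>v| \<le> M / (1 + |x|)\<close> multiply to the quadratic decay of the convection term;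
  outside a ball the force decays faster than that.
\<close>

lemma forcing_bound_NS:
  assumes "a > 3" "T > 0" "M \<ge> 0"
    and f_meas: "jointly_measurable f"
    and f_diff: "\<And>x t. t \<ge> 0 \<Longrightarrow> (\<lambda>y. f y t) differentiable (at x)"
    and f_bound: "(\<lambda>(x, t). norm (f x t) + norm (grad f x t))
                     \<in> O[unif_at_infinity T](\<lambda>(x, t). (1 + norm x) powr (- a))"
    and f_L2: "(\<integral>\<^sup>+ t\<in>{0..T}. L2_norm_at f t \<partial>lborel) < \<infinity>"
    and M: "\<And>t x. 0 \<le> t \<Longrightarrow> t \<le> T \<Longrightarrow> norm (v x t) \<le> M * (1 + norm x) powr (-1)"
      "\<And>t x. 0 \<le> t \<Longrightarrow> t \<le> T \<Longrightarrow> norm (grad v x t) \<le> M * (1 + norm x) powr (-1)"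
  obtains A R where "R \<ge> 0" "forcing_bound T A R f (\<lambda>y s. f y s - convect v y s)"
proof -
  have slice: "(\<lambda>y. f y s) \<in> borel_measurable borel" if "s \<ge> 0" for s
    using f_diff[OF that]
    by (intro borel_measurable_continuous_onI)
       (simp add: continuous_on_eq_continuous_at differentiable_imp_continuous_within)
  obtain C where C: "C > 0" and "\<forall>\<^sub>F p in unif_at_infinity T.
      norm (case p of (x, t) \<Rightarrow> norm (f x t) + norm (grad f x t))
      \<le> C * norm (case p of (x, t) \<Rightarrow> (1 + norm x) powr (- a))"
    by (rule landau_o.bigE[OF f_bound])
  then obtain Pf Pg where Pfg: "eventually Pf at_infinity" "\<forall>t\<in>{0..T}. Pg t"
    "\<And>x t. Pf x \<Longrightarrow> Pg t \<Longrightarrow>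
      norm (norm (f x t) + norm (grad f x t)) \<le> C * norm ((1 + norm x) powr (- a))"
    unfolding unif_at_infinity_def eventually_prod_filter eventually_principal by fastforce
  have Pf: "norm (f x t) + norm (grad f x t) \<le> C * (1 + norm x) powr (- a)"
    if "Pf x" "t \<in> {0..T}" for x t
    using Pfg(3)[of x t] Pfg(2) that by simp
  from Pfg(1) obtain b where b: "\<And>x. b \<le> norm x \<Longrightarrow> Pf x"
    unfolding eventually_at_infinity by blast
  define R where "R = max b 0"
  define A where "A = C + 3 * M\<^sup>2"
  define V where "V = 1 + measure lborel (cball 0 R :: vec3 set)"
  show thesis
  proof (rule that[of R A])
    show "R \<ge> 0" by (simp add: R_def)
    show "forcing_bound T A R f (\<lambda>y s. f y s - convect v y s)"
      unfolding forcing_bound_def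
    proof (intro conjI allI impI ballI)
      show "A \<ge> 0" using C by (simp add: A_def)
      show "jointly_measurable f" by fact
      show "(\<lambda>y. f y s) \<in> borel_measurable borel" if "s \<ge> 0" for s by (rule slice[OF that])
      have V: "V \<ge> 1" by (simp add: V_def)
      \<comment> \<open>the constant goes with the local mass, whose measurability in time allows it to leave the integral\<close>
      have mass: "ennreal (1 / V) * local_mass R f s \<le> L2_norm_at f s" if "s \<ge> 0" for s
      proof -
        have "ennreal (1 / V) * local_mass R f s \<le> ennreal (1 / V) * (ennreal V * L2_norm_at f s)"
          unfolding V_def by (intro mult_left_mono local_mass_le_L2_norm slice that) simp
        also have "\<dots> = L2_norm_at f s"
          using V by (simp flip: ennreal_mult mult.assoc)
        finally show ?thesis .
      qed
      have "ennreal (1 / V) * (\<integral>\<^sup>+ s\<in>{0..T}. local_mass R f s \<partial>lborel)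
          = (\<integral>\<^sup>+ s. ennreal (1 / V) * (local_mass R f s * indicator {0..T} s) \<partial>lborel)"
        by (intro nn_integral_cmult[symmetric] local_mass_measurable f_meas)
      also have "\<dots> \<le> (\<integral>\<^sup>+ s\<in>{0..T}. L2_norm_at f s \<partial>lborel)"
        using mass by (intro nn_integral_mono) (auto simp: indicator_def)
      also have "\<dots> < \<infinity>" by (rule f_L2)
      finally show "(\<integral>\<^sup>+ s\<in>{0..T}. local_mass R f s \<partial>lborel) < \<infinity>"
        using V by (auto simp: ennreal_mult_less_top)
      fix s y assume s: "s \<in> {0..T}"
      have far: "norm (f y s) \<le> C * (1 + norm y) powr (-2)" if "R < norm y"
      proof -
        have "norm (f y s) \<le> norm (f y s) + norm (grad f y s)" by simp
        also have "\<dots> \<le> C * (1 + norm y) powr (- a)"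
          using Pf[OF b s, of y] that by (simp add: R_def)
        also have "\<dots> \<le> C * (1 + norm y) powr (-2)"
          using C \<open>a > 3\<close> by (intro mult_left_mono powr_mono) auto
        finally show ?thesis .
      qed
      have f: "norm (f y s) \<le> C * (1 + norm y) powr (-2) + indicator (cball 0 R) y * norm (f y s)"
        using far C by (cases "norm y \<le> R") auto
      have "norm (convect v y s) \<le> 3 * (norm (v y s) * norm (grad v y s))"
        using norm_convect_le[of v y s] by simp
      also have "\<dots> \<le> 3 * ((M * (1 + norm y) powr (-1)) * (M * (1 + norm y) powr (-1)))"
        using s \<open>M \<ge> 0\<close> by (intro mult_left_mono mult_mono M) simp_all
      also have "\<dots> = 3 * M\<^sup>2 * ((1 + norm y) powr (-1) * (1 + norm y) powr (-1))"
        by (simp add: power2_eq_square)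
      also have "(1 + norm y) powr (-1) * (1 + norm y) powr (-1) = (1 + norm y) powr (-2)"
        by (simp only: flip: powr_add) simp
      finally have "norm (convect v y s) \<le> 3 * M\<^sup>2 * (1 + norm y) powr (-2)" .
      then show "norm (f y s - convect v y s) \<le> A * (1 + norm y) powr (-2) + indicator (cball 0 R) y * norm (f y s)"
        using f norm_triangle_ineq4[of "f y s" "convect v y s"] by (simp add: A_def distrib_right)
    qed
  qed
qed

theorem theorem2:
  fixes \<nu> a :: real
    and v0 :: "real ^ 3 \<Rightarrow> real ^ 3"
    and v f :: "real ^ 3 \<Rightarrow> real \<Rightarrow> real ^ 3"
    and p :: "real ^ 3 \<Rightarrow> real \<Rightarrow> real"
  assumes "\<nu> > 0"
    and "a > 3"
    and v0_diff: "\<And>x. v0 differentiable (at x)"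
    and v0_div: "\<And>x. divergence v0 x = 0"
    and v0_bound: "(\<lambda>x. norm (v0 x) + norm (jacobian v0 (at x)))
                     \<in> O[at_infinity](\<lambda>x. (1 + norm x) powr (- a))"
    and f_meas: "jointly_measurable f"
    and f_diff: "\<And>x t. t \<ge> 0 \<Longrightarrow> (\<lambda>y. f y t) differentiable (at x)"
    and f_bound: "\<And>T. T > 0 \<Longrightarrow> (\<lambda>(x, t). norm (f x t) + norm (grad f x t))
                     \<in> O[unif_at_infinity T](\<lambda>(x, t). (1 + norm x) powr (- a))"
    and decay: "decays_uniformly v" "decays_uniformly f" "decays_uniformly p"
    and sol: "NS_solution \<nu> f v0 v"
    and f_L2: "\<And>T. T > 0 \<Longrightarrow> (\<integral>\<^sup>+ t\<in>{0..T}. L2_norm_at f t \<partial>lborel) < \<infinity>"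
    and E0: "energy v 0 < \<infinity>"
  shows "\<forall>T>0. (SUP t\<in>{0..T}. energy v t) < \<infinity>
              \<and> (\<integral>\<^sup>+ t\<in>{0..T}. grad_norm_sq v t \<partial>lborel) < \<infinity>"
proof (intro allI impI)
  fix T :: real assume T: "T > 0"
  let ?F = "\<lambda>y s. f y s - convect v y s" and ?W = "\<lambda>x. (1 + norm (x :: vec3)) powr (-7/4)"
  have v_diff: "(\<lambda>y. v y t) differentiable (at x)" if "t \<ge> 0" for x t
    using sol that by (simp add: NS_solution_def)
  have conv: "duhamel_converges \<nu> ?F x t" if "t \<ge> 0" for x t
    using sol that unfolding NS_solution_def satisfies_integral_eq_def duhamel_converges_def duhamel_integrand_def
    by blast
  have rep: "v x t = duhamel_term \<nu> ?F x t + heat_flow \<nu> v0 x t" if "t \<ge> 0" for x t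
    using sol that unfolding NS_solution_def satisfies_integral_eq_def duhamel_term_def duhamel_integrand_def
    by blast
  have "bdd_above ((\<lambda>(x, t). (norm (v x t) + norm (grad v x t)) * (1 + norm x)) ` (UNIV \<times> {0..T}))"
    using sol T by (simp add: NS_solution_def)
  then obtain M0 where bd: "\<And>z. z \<in> (\<lambda>(x, t). (norm (v x t) + norm (grad v x t)) * (1 + norm x)) ` (UNIV \<times> {0..T}) \<Longrightarrow> z \<le> M0"
    unfolding bdd_above_def by blast
  have M0: "(norm (v x t) + norm (grad v x t)) * (1 + norm x) \<le> M0" if "t \<in> {0..T}" for x t
    using that by (intro bd image_eqI[of _ _ "(x, t)"]) auto
  define M where "M = max M0 0"
  have M: "M \<ge> 0" by (simp add: M_def)
  have vM: "norm (v x t) \<le> M * (1 + norm x) powr (-1)" and gM: "norm (grad v x t) \<le> M * (1 + norm x) powr (-1)"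
    if "0 \<le> t" "t \<le> T" for x t
  proof -
    have pos: "1 + norm x > 0" by (simp add: add_pos_nonneg)
    have "norm (v x t) + norm (grad v x t) \<le> M / (1 + norm x)"
      using M0[of t x] that pos by (simp add: pos_le_divide_eq M_def)
    also have "\<dots> = M * (1 + norm x) powr (-1)" using pos by simp
    finally have "norm (v x t) + norm (grad v x t) \<le> M * (1 + norm x) powr (-1)" .
    then show "norm (v x t) \<le> M * (1 + norm x) powr (-1)" "norm (grad v x t) \<le> M * (1 + norm x) powr (-1)"
      using norm_ge_zero[of "v x t"] norm_ge_zero[of "grad v x t"] by linarith+
  qed
  have weak: "M * (1 + norm x) powr (-1) \<le> M" for x :: vec3
    using mult_left_mono[OF powr_mono2'[of "-1" 1 "1 + norm x"] M] by simp
  obtain A R where R: "R \<ge> 0" and forcing: "forcing_bound T A R f ?F"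
    using forcing_bound_NS[OF \<open>a > 3\<close> T M f_meas f_diff f_bound[OF T] f_L2[OF T] vM gM] by blast
  obtain C where C: "C \<ge> 0"
    and duh0: "\<And>t x. 0 \<le> t \<Longrightarrow> t \<le> T \<Longrightarrow> 1 + 4 * R \<le> norm x \<Longrightarrow> duhamel_converges \<nu> ?F x t \<Longrightarrow>
       norm (duhamel_term \<nu> ?F x t) \<le> C * ?W x"
    and duh0': "\<And>t x x'. 0 \<le> t \<Longrightarrow> t \<le> T \<Longrightarrow> 1 + 4 * R \<le> norm x \<Longrightarrow> norm (x' - x) \<le> 1/4 \<Longrightarrow>
       duhamel_converges \<nu> ?F x t \<Longrightarrow> duhamel_converges \<nu> ?F x' t \<Longrightarrow>
       norm (duhamel_term \<nu> ?F x' t - duhamel_term \<nu> ?F x t) \<le> C * norm (x' - x) * ?W x"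
    using duhamel_decay[OF \<open>\<nu> > 0\<close> T forcing] by blast
  note duh = duh0[OF _ _ _ conv] and duh' = duh0'[OF _ _ _ _ conv conv]
  \<comment> \<open>the datum is bounded because it is the value of the solution at time \<open>0\<close>\<close>
  have v_init: "v x 0 = v0 x" for x
  proof -
    have "duhamel_term \<nu> ?F x 0 = 0"
      unfolding duhamel_term_def set_lebesgue_integral_def
      by (rule integral_eq_zero_AE) (use AE_lborel_singleton[of 0] in \<open>auto elim!: eventually_mono\<close>)
    then show ?thesis using rep[of 0 x] by (simp add: heat_flow_def)
  qed
  have v0M: "norm (v0 x) \<le> M" for x
    using vM[of 0 x] weak[of x] T by (simp add: v_init)
  obtain D where D: "\<And>y. norm (v0 y) \<le> D * (1 + norm y) powr (-a)"
    using bigo_at_infinity_imp_global_decay[OF v0M M _ v0_bound] \<open>a > 3\<close> by auto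
  have v0_meas: "v0 \<in> borel_measurable borel"
    using v0_diff
    by (intro borel_measurable_continuous_onI)
       (simp add: continuous_on_eq_continuous_at differentiable_imp_continuous_within)
  obtain H where H: "H \<ge> 0"
    and heat: "\<And>t x. t \<ge> 0 \<Longrightarrow> norm (heat_flow \<nu> v0 x t) \<le> H * ?W x"
    and heat': "\<And>t x x'. t > 0 \<Longrightarrow> norm (x' - x) \<le> 1/2 \<Longrightarrow>
       norm (heat_flow \<nu> v0 x' t - heat_flow \<nu> v0 x t)
       \<le> H * norm (x' - x) * (diffusion_length \<nu> t powr (-5/4) + diffusion_length \<nu> t powr (-1)) * ?W x"
    using heat_flow_decay[OF \<open>\<nu> > 0\<close> \<open>a > 3\<close> v0_meas D] by blast
  obtain L where L: "L \<ge> 0" "\<And>\<tau> q. 0 < \<tau> \<Longrightarrow> \<tau> \<le> T \<Longrightarrow> 0 \<le> q \<Longrightarrow> q \<le> 5/4 \<Longrightarrow>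
       diffusion_length \<nu> \<tau> powr (-q) \<le> L * \<tau> powr (-5/8)"
    using diffusion_length_powr_le[OF \<open>\<nu> > 0\<close> T] by blast
  define \<rho> where "\<rho> = 1 + 4 * R"
  define S where "S = M * (1 + \<rho>) powr (7/4)"
  have \<rho>: "\<rho> \<ge> 0" and S: "S \<ge> 0" using R M by (simp_all add: \<rho>_def S_def)
  \<comment> \<open>for \<open>|x| \<le> \<rho>\<close> the far-field estimates give nothing, and the a priori bounds take over\<close>
  have near: "M \<le> S * ?W x" if "norm x \<le> \<rho>" for x
    using mult_left_mono[OF powr_extend[OF that \<rho>, of "7/4"] M] by (simp add: S_def mult.assoc)
  have vC: "norm (v x t) \<le> (C + H + S) * ?W x" if t: "0 \<le> t" "t \<le> T" for t x
  proof (cases "norm x \<le> \<rho>")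
    case True
    have "norm (v x t) \<le> S * ?W x" using vM[OF t, of x] weak[of x] near[OF True] by linarith
    also have "\<dots> \<le> (C + H + S) * ?W x" using C H by (intro mult_right_mono) auto
    finally show ?thesis .
  next
    case False
    have "norm (v x t) \<le> norm (duhamel_term \<nu> ?F x t) + norm (heat_flow \<nu> v0 x t)"
      unfolding rep[OF t(1)] by (rule norm_triangle_ineq)
    also have "\<dots> \<le> C * ?W x + H * ?W x"
      using False t by (intro add_mono duh heat) (auto simp: \<rho>_def)
    also have "\<dots> \<le> (C + H + S) * ?W x" using S by (simp add: distrib_right)
    finally show ?thesis .
  qed
  define P where "P = 9 * (C * T powr (5/8) + 2 * H * L) + S * T powr (5/8)"
  have P: "P \<ge> 0" using C H L S by (simp add: P_def)
  have gP: "norm (grad v x t) \<le> P * t powr (-5/8) * ?W x" if t: "0 < t" "t \<le> T" for t x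
  proof -
    have T1: "1 \<le> T powr (5/8) * t powr (-5/8)"
      using powr_mono2[of "5/8" t T] t by (simp add: powr_minus_divide)
    show ?thesis
    proof (cases "norm x \<le> \<rho>")
      case True
      have "norm (grad v x t) \<le> S * ?W x * 1"
        using gM[of t x] t weak[of x] near[OF True] by simp
      also have "\<dots> \<le> S * ?W x * (T powr (5/8) * t powr (-5/8))"
        using S by (intro mult_left_mono T1) auto
      also have "\<dots> = (S * T powr (5/8)) * t powr (-5/8) * ?W x" by simp
      also have "\<dots> \<le> P * t powr (-5/8) * ?W x"
        using C H L by (intro mult_right_mono) (auto simp: P_def)
      finally show ?thesis .
    next
      case False
      define B where "B = (C * T powr (5/8) + 2 * H * L) * t powr (-5/8) * ?W x"
      have "norm (v x' t - v x t) \<le> B * norm (x' - x)" if x': "norm (x' - x) \<le> 1/4" for x'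
      proof -
        let ?h = "norm (x' - x)" and ?c = "diffusion_length \<nu> t"
        have "C * ?h * ?W x * 1 \<le> C * ?h * ?W x * (T powr (5/8) * t powr (-5/8))"
          using C by (intro mult_left_mono T1) auto
        moreover have "norm (duhamel_term \<nu> ?F x' t - duhamel_term \<nu> ?F x t) \<le> C * ?h * ?W x"
          using False t x' by (intro duh') (auto simp: \<rho>_def)
        ultimately have 1: "norm (duhamel_term \<nu> ?F x' t - duhamel_term \<nu> ?F x t)
            \<le> C * ?h * ?W x * (T powr (5/8) * t powr (-5/8))" by simp
        have "?c powr (-5/4) + ?c powr (-1) \<le> 2 * L * t powr (-5/8)"
          using L(2)[of t "5/4"] L(2)[of t 1] t by simp
        then have "H * ?h * (?c powr (-5/4) + ?c powr (-1)) * ?W x \<le> H * ?h * (2 * L * t powr (-5/8)) * ?W x"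
          using H by (intro mult_right_mono mult_left_mono) auto
        then have 2: "norm (heat_flow \<nu> v0 x' t - heat_flow \<nu> v0 x t) \<le> H * ?h * (2 * L * t powr (-5/8)) * ?W x"
          using heat'[of t x' x] t x' by simp
        have "v x' t - v x t = (duhamel_term \<nu> ?F x' t - duhamel_term \<nu> ?F x t)
            + (heat_flow \<nu> v0 x' t - heat_flow \<nu> v0 x t)"
          using t by (simp add: rep)
        then have "norm (v x' t - v x t) \<le> norm (duhamel_term \<nu> ?F x' t - duhamel_term \<nu> ?F x t)
            + norm (heat_flow \<nu> v0 x' t - heat_flow \<nu> v0 x t)"
          by (simp only: norm_triangle_ineq)
        also have "\<dots> \<le> C * ?h * ?W x * (T powr (5/8) * t powr (-5/8)) + H * ?h * (2 * L * t powr (-5/8)) * ?W x"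
          by (rule add_mono[OF 1 2])
        also have "\<dots> = B * ?h" by (simp add: B_def algebra_simps)
        finally show ?thesis .
      qed
      then have "norm (grad v x t) \<le> 9 * B"
        unfolding grad_def using v_diff[of t x] t by (intro norm_jacobian_le[where \<delta> = "1/4"]) auto
      also have "\<dots> = (9 * (C * T powr (5/8) + 2 * H * L)) * t powr (-5/8) * ?W x" by (simp add: B_def)
      also have "\<dots> \<le> P * t powr (-5/8) * ?W x"
        using S by (intro mult_right_mono) (auto simp: P_def)
      finally show ?thesis .
    qed
  qed
  have gM': "norm (grad v x t) \<le> M * (1 + norm x) powr (-1)" if "0 < t" "t \<le> T" for t x
    using gM that by simp
  have "C + H + S \<ge> 0" using C H S by simp
  from energy_class_bounds[OF T M this P vC gM' gP]
  show "(SUP t\<in>{0..T}. energy v t) < \<infinity> \<and> (\<integral>\<^sup>+ t\<in>{0..T}. grad_norm_sq v t \<partial>lborel) < \<infinity>"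
    by blast
qed

end
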